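(* There exist a (connected, infinite) median graph $G^*$ and a vertex $\alpha$ of $G^*$ such that the pointed median graph $G^*_\alpha$ has maximum out-degree $5$ and the pointed contact graph $\Gamma_\alpha(G^* )$ has infinite chromatic number. In particular, any nice labeling of the event structure $\mathcal E_\alpha$ (of degree $5$) whose domain is $G^*_\alpha$ requires an infinite number of labels.
   Context: Graphs are simple and connected, possibly infinite, with the shortest-path distance $d$. The interval is $I(u,v)=\{x: d(u,x)+d(x,v)=d(u,v)\}$. A graph is median if $I(x,y)\cap I(y,z)\cap I(z,x)$ is a single vertex for every triple of vertices $x,y,z$. For a vertex $v$ of a median graph $G$, the pointed median graph $G_v$ is $G$ with each edge $xy$ directed from $x$ to $y$ iff $d(x,v)<d(y,v)$; the origin of a directed edge is its tail, and out-degrees refer to this orientation. The Djoković–Winkler relation $\Theta$ on edges: $xy\,\Theta\, zw$ iff $d(x,z)+d(y,w)\neq d(x,w)+d(y,z)$; in a median graph it is an equivalence relation, and each class $\Theta_i$ splits the vertex set into two complementary halfspaces $A_i\ni v$ and $B_i$. Two classes $\Theta_i,\Theta_j$ cross if some 4-cycle has two opposite edges in $\Theta_i$ and the other two in $\Theta_j$; otherwise they are compatible. $\Theta_i$ separates $v$ from $\Theta_j$ if they are compatible and all edges of $\Theta_j$ lie in $B_i$. The pointed contact graph $\Gamma_v(G)$ has the $\Theta$-classes as vertices, two distinct classes $\Theta_i,\Theta_j$ being adjacent iff they cross or there are edges $e\in\Theta_i$, $e'\in\Theta_j$ which, directed as in $G_v$, have the same origin and do not lie in a common 4-cycle. An event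 structure is $\mathcal E=(E,\le,\smile)$ with $\le$ a partial order on $E$ such that $\{e'\,:\,e'\le e\}$ is finite for every $e$, $\smile$ an irreflexive symmetric binary relation (conflict), and $e\smile e'$, $e'\le e''$ imply $e\smile e''$. Its configurations are the conflict-free, downward-closed subsets of $E$; its domain is the set of configurations ordered by inclusion. Two events are concurrent if they are $\le$-incomparable and not in conflict; a conflict $e'\smile e''$ is minimal if there is no $e\ne e',e''$ with ($e\le e'$ and $e\smile e''$) or ($e\le e''$ and $e\smile e'$). Events are independent if concurrent or in minimal conflict; the degree of $\mathcal E$ is the supremum of sizes of sets of pairwise independent events. A nice labeling is a map $\lambda:E\to\Lambda$ giving distinct labels to any two independent events. For a pointed median graph $G_v$, the event structure $\mathcal E_v$ has as events the $\Theta$-classes of $G$, with $\Theta_i\le\Theta_j$ iff $\Theta_i=\Theta_j$ or $\Theta_i$ separates $v$ from $\Theta_j$, and $\Theta_i\smile\Theta_j$ iff they are compatible and neither separates $v$ from the other; the Hasse diagram of its domain is isomorphic to $G_v$ (this is what "whose domain is $G_v$" means). *)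

theory Defs
  imports Main
begin

definition simple_graph :: "'a set \<Rightarrow> ('a \<Rightarrow> 'a \<Rightarrow> bool) \<Rightarrow> bool" where
  "simple_graph V Adj \<longleftrightarrow>
     (\<forall>x y. Adj x y \<longrightarrow> x \<in> V \<and> y \<in> V \<and> x \<noteq> y \<and> Adj y x)"

definition gpath :: "'a set \<Rightarrow> ('a \<Rightarrow> 'a \<Rightarrow> bool) \<Rightarrow> 'a list \<Rightarrow> bool" where
  "gpath V Adj p \<longleftrightarrow> p \<noteq> [] \<and> set p \<subseteq> V \<and>
     (\<forall>i. Suc i < length p \<longrightarrow> Adj (p ! i) (p ! Suc i))"

definition connected_graph :: "'a set \<Rightarrow> ('a \<Rightarrow> 'a \<Rightarrow> bool) \<Rightarrow> bool" where
  "connected_graph V Adj \<longleftrightarrow>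
     (\<forall>x\<in>V. \<forall>y\<in>V. \<exists>p. gpath V Adj p \<and> hd p = x \<and> last p = y)"

definition gdist :: "'a set \<Rightarrow> ('a \<Rightarrow> 'a \<Rightarrow> bool) \<Rightarrow> 'a \<Rightarrow> 'a \<Rightarrow> nat" where
  "gdist V Adj x y =
     (LEAST n. \<exists>p. gpath V Adj p \<and> hd p = x \<and> last p = y \<and> length p = Suc n)"

definition interval :: "'a set \<Rightarrow> ('a \<Rightarrow> 'a \<Rightarrow> bool) \<Rightarrow> 'a \<Rightarrow> 'a \<Rightarrow> 'a set" where
  "interval V Adj u v =
     {x \<in> V. gdist V Adj u x + gdist V Adj x v = gdist V Adj u v}"

definition median_graph :: "'a set \<Rightarrow> ('a \<Rightarrow> 'a \<Rightarrow> bool) \<Rightarrow> bool" where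
  "median_graph V Adj \<longleftrightarrow> simple_graph V Adj \<and> connected_graph V Adj \<and>
     (\<forall>x\<in>V. \<forall>y\<in>V. \<forall>z\<in>V. \<exists>!m.
        m \<in> interval V Adj x y \<inter> interval V Adj y z \<inter> interval V Adj z x)"

definition out_nbrs :: "'a set \<Rightarrow> ('a \<Rightarrow> 'a \<Rightarrow> bool) \<Rightarrow> 'a \<Rightarrow> 'a \<Rightarrow> 'a set" where
  "out_nbrs V Adj v x = {y. Adj x y \<and> gdist V Adj x v < gdist V Adj y v}"

definition max_outdeg_eq :: "'a set \<Rightarrow> ('a \<Rightarrow> 'a \<Rightarrow> bool) \<Rightarrow> 'a \<Rightarrow> nat \<Rightarrow> bool" where
  "max_outdeg_eq V Adj v k \<longleftrightarrow>
     (\<forall>x\<in>V. finite (out_nbrs V Adj v x) \<and> card (out_nbrs V Adj v x) \<le> k) \<and>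
     (\<exists>x\<in>V. card (out_nbrs V Adj v x) = k)"

text \<open>Edges are represented as ordered pairs; a Theta-class contains both orientations.\<close>
definition gedges :: "'a set \<Rightarrow> ('a \<Rightarrow> 'a \<Rightarrow> bool) \<Rightarrow> ('a \<times> 'a) set" where
  "gedges V Adj = {(x, y). Adj x y}"

definition theta :: "'a set \<Rightarrow> ('a \<Rightarrow> 'a \<Rightarrow> bool) \<Rightarrow> 'a \<times> 'a \<Rightarrow> 'a \<times> 'a \<Rightarrow> bool" where
  "theta V Adj e f \<longleftrightarrow> (case e of (x, y) \<Rightarrow> case f of (z, w) \<Rightarrow>
     gdist V Adj x z + gdist V Adj y w \<noteq> gdist V Adj x w + gdist V Adj y z)"

definition theta_classes :: "'a set \<Rightarrow> ('a \<Rightarrow> 'a \<Rightarrow> bool) \<Rightarrow> ('a \<times> 'a) set set" where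
  "theta_classes V Adj =
     {{f \<in> gedges V Adj. theta V Adj e f} | e. e \<in> gedges V Adj}"

definition far_half :: "'a set \<Rightarrow> ('a \<Rightarrow> 'a \<Rightarrow> bool) \<Rightarrow> 'a \<Rightarrow> ('a \<times> 'a) set \<Rightarrow> 'a set" where
  "far_half V Adj v C = {z \<in> V. \<exists>x y. (x, y) \<in> C \<and>
       gdist V Adj v x < gdist V Adj v y \<and> gdist V Adj z y < gdist V Adj z x}"

definition cycle4 :: "('a \<Rightarrow> 'a \<Rightarrow> bool) \<Rightarrow> 'a \<Rightarrow> 'a \<Rightarrow> 'a \<Rightarrow> 'a \<Rightarrow> bool" where
  "cycle4 Adj a b c d \<longleftrightarrow> distinct [a, b, c, d] \<and>
     Adj a b \<and> Adj b c \<and> Adj c d \<and> Adj d a"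

definition crosses :: "'a set \<Rightarrow> ('a \<Rightarrow> 'a \<Rightarrow> bool) \<Rightarrow> ('a \<times> 'a) set \<Rightarrow> ('a \<times> 'a) set \<Rightarrow> bool" where
  "crosses V Adj Ci Cj \<longleftrightarrow> (\<exists>a b c d. cycle4 Adj a b c d \<and>
     (a, b) \<in> Ci \<and> (c, d) \<in> Ci \<and> (b, c) \<in> Cj \<and> (d, a) \<in> Cj)"

definition compatible :: "'a set \<Rightarrow> ('a \<Rightarrow> 'a \<Rightarrow> bool) \<Rightarrow> ('a \<times> 'a) set \<Rightarrow> ('a \<times> 'a) set \<Rightarrow> bool" where
  "compatible V Adj Ci Cj \<longleftrightarrow> \<not> crosses V Adj Ci Cj"

definition separates :: "'a set \<Rightarrow> ('a \<Rightarrow> 'a \<Rightarrow> bool) \<Rightarrow> 'a \<Rightarrow> ('a \<times> 'a) set \<Rightarrow> ('a \<times> 'a) set \<Rightarrow> bool" where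
  "separates V Adj v Ci Cj \<longleftrightarrow> compatible V Adj Ci Cj \<and>
     (\<forall>(x, y) \<in> Cj. x \<in> far_half V Adj v Ci \<and> y \<in> far_half V Adj v Ci)"

definition in_common_c4 :: "('a \<Rightarrow> 'a \<Rightarrow> bool) \<Rightarrow> 'a \<times> 'a \<Rightarrow> 'a \<times> 'a \<Rightarrow> bool" where
  "in_common_c4 Adj e f \<longleftrightarrow> (\<exists>a b c d. cycle4 Adj a b c d \<and>
     {fst e, snd e} \<in> {{a, b}, {b, c}, {c, d}, {d, a}} \<and>
     {fst f, snd f} \<in> {{a, b}, {b, c}, {c, d}, {d, a}})"

definition contact_adj :: "'a set \<Rightarrow> ('a \<Rightarrow> 'a \<Rightarrow> bool) \<Rightarrow> 'a \<Rightarrow> ('a \<times> 'a) set \<Rightarrow> ('a \<times> 'a) set \<Rightarrow> bool" where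
  "contact_adj V Adj v Ci Cj \<longleftrightarrow> Ci \<noteq> Cj \<and>
     (crosses V Adj Ci Cj \<or>
      (\<exists>x y y'. (x, y) \<in> Ci \<and> (x, y') \<in> Cj \<and>
         gdist V Adj x v < gdist V Adj y v \<and> gdist V Adj x v < gdist V Adj y' v \<and>
         \<not> in_common_c4 Adj (x, y) (x, y')))"

definition infinite_chromatic_contact :: "'a set \<Rightarrow> ('a \<Rightarrow> 'a \<Rightarrow> bool) \<Rightarrow> 'a \<Rightarrow> bool" where
  "infinite_chromatic_contact V Adj v \<longleftrightarrow>
     \<not> (\<exists>col :: ('a \<times> 'a) set \<Rightarrow> nat. finite (col ` theta_classes V Adj) \<and>
          (\<forall>Ci\<in>theta_classes V Adj. \<forall>Cj\<in>theta_classes V Adj.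
             contact_adj V Adj v Ci Cj \<longrightarrow> col Ci \<noteq> col Cj))"

definition ev_le :: "'a set \<Rightarrow> ('a \<Rightarrow> 'a \<Rightarrow> bool) \<Rightarrow> 'a \<Rightarrow> ('a \<times> 'a) set \<Rightarrow> ('a \<times> 'a) set \<Rightarrow> bool" where
  "ev_le V Adj v Ci Cj \<longleftrightarrow> Ci = Cj \<or> separates V Adj v Ci Cj"

definition ev_conflict :: "'a set \<Rightarrow> ('a \<Rightarrow> 'a \<Rightarrow> bool) \<Rightarrow> 'a \<Rightarrow> ('a \<times> 'a) set \<Rightarrow> ('a \<times> 'a) set \<Rightarrow> bool" where
  "ev_conflict V Adj v Ci Cj \<longleftrightarrow> Ci \<noteq> Cj \<and> compatible V Adj Ci Cj \<and>
     \<not> separates V Adj v Ci Cj \<and> \<not> separates V Adj v Cj Ci"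

definition ev_concurrent :: "'a set \<Rightarrow> ('a \<Rightarrow> 'a \<Rightarrow> bool) \<Rightarrow> 'a \<Rightarrow> ('a \<times> 'a) set \<Rightarrow> ('a \<times> 'a) set \<Rightarrow> bool" where
  "ev_concurrent V Adj v e f \<longleftrightarrow> \<not> ev_le V Adj v e f \<and> \<not> ev_le V Adj v f e \<and>
     \<not> ev_conflict V Adj v e f"

definition ev_min_conflict :: "'a set \<Rightarrow> ('a \<Rightarrow> 'a \<Rightarrow> bool) \<Rightarrow> 'a \<Rightarrow> ('a \<times> 'a) set \<Rightarrow> ('a \<times> 'a) set \<Rightarrow> bool" where
  "ev_min_conflict V Adj v e' e'' \<longleftrightarrow> ev_conflict V Adj v e' e'' \<and>
     \<not> (\<exists>e\<in>theta_classes V Adj. e \<noteq> e' \<and> e \<noteq> e'' \<and>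
          ((ev_le V Adj v e e' \<and> ev_conflict V Adj v e e'') \<or>
           (ev_le V Adj v e e'' \<and> ev_conflict V Adj v e e')))"

definition ev_independent :: "'a set \<Rightarrow> ('a \<Rightarrow> 'a \<Rightarrow> bool) \<Rightarrow> 'a \<Rightarrow> ('a \<times> 'a) set \<Rightarrow> ('a \<times> 'a) set \<Rightarrow> bool" where
  "ev_independent V Adj v e f \<longleftrightarrow> ev_concurrent V Adj v e f \<or> ev_min_conflict V Adj v e f"

definition ev_degree_eq :: "'a set \<Rightarrow> ('a \<Rightarrow> 'a \<Rightarrow> bool) \<Rightarrow> 'a \<Rightarrow> nat \<Rightarrow> bool" where
  "ev_degree_eq V Adj v k \<longleftrightarrow>
     (\<forall>S \<subseteq> theta_classes V Adj.
        (\<forall>e\<in>S. \<forall>f\<in>S. e \<noteq> f \<longrightarrow> ev_independent V Adj v e f) \<longrightarrow>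
        finite S \<and> card S \<le> k) \<and>
     (\<exists>S \<subseteq> theta_classes V Adj.
        (\<forall>e\<in>S. \<forall>f\<in>S. e \<noteq> f \<longrightarrow> ev_independent V Adj v e f) \<and> card S = k)"

definition nice_labeling :: "'a set \<Rightarrow> ('a \<Rightarrow> 'a \<Rightarrow> bool) \<Rightarrow> 'a \<Rightarrow> (('a \<times> 'a) set \<Rightarrow> 'l) \<Rightarrow> bool" where
  "nice_labeling V Adj v lab \<longleftrightarrow>
     (\<forall>e\<in>theta_classes V Adj. \<forall>f\<in>theta_classes V Adj.
        ev_independent V Adj v e f \<longrightarrow> lab e \<noteq> lab f)"

end

theory Submission
  imports Defs "HOL-Library.Sublist" "HOL-Library.Countable_Set"
begin

text \<open>The finite configurations of an event structure, adjacent when they differ by one event, form a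
  median graph: the distance is the size of the symmetric difference, the median is the majority vote,
  and the classes of the Djokovic-Winkler relation are the events. So it suffices to find an event
  structure of degree 5 without a finite nice labeling. Burling's triangle-free graphs of large chromatic
  number are represented by products of a subtree of the infinite binary tree and an interval of natural
  numbers, two vertices being adjacent iff their products meet. Take the events of the binary tree
  (incomparable nodes in conflict) and of an independent chain, and add for every Burling vertex an event
  that is enabled exactly on its product, all these in mutual conflict. Two added events are independent
  iff their vertices are adjacent, and pairwise independent events comprise at most two nodes (siblings),
  one element of the chain and two added events.\<close>

text \<open>Burling's graphs arose as intersection graphs of boxes in space. The branching of the
  tree is essential: with a path in its place the products would be rectangles in a plane, whose
  intersection graphs have chromatic number bounded in terms of the clique number. A product can be
  turned into an event because it is convex: entering it is expressed by causality (the prefixes of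
  the root and the first \<open>lo v\<close> ticks), leaving it by conflict. As two added events
  always conflict, they are independent exactly when this conflict is not inherited, that is, when
  some configuration enables both, and this is where the products meet. All stages share one tree
  and one chain, so that a single graph defeats every finite number of labels; the stages are
  nested, so that triangle-freeness of each stage bounds the independent sets of the whole
  structure.\<close>

section \<open>Symmetric differences of finite sets as a distance\<close>

definition sdiff :: "'a set \<Rightarrow> 'a set \<Rightarrow> 'a set" where
  "sdiff A B = sym_diff A B"

lemma sdiff_commute: "sdiff A B = sdiff B A"
  by (auto simp: sdiff_def)

lemma finite_sdiff: "finite A \<Longrightarrow> finite B \<Longrightarrow> finite (sdiff A B)"
  by (auto simp: sdiff_def)

lemma sdiff_empty_iff: "sdiff A B = {} \<longleftrightarrow> A = B"
  by (auto simp: sdiff_def)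

lemma sdiff_insert: "e \<notin> A \<Longrightarrow> sdiff A (insert e A) = {e}"
  by (auto simp: sdiff_def)

lemma sdiff_singletonD:
  assumes "sdiff A B = {e}"
  shows "x \<in> B \<longleftrightarrow> (if x = e then x \<notin> A else x \<in> A)"
proof -
  have "x \<in> sdiff A B \<longleftrightarrow> x = e" using assms by simp
  then show ?thesis by (auto simp: sdiff_def)
qed

lemma sdiff_singleton_cases:
  assumes "sdiff A B = {e}"
  obtains "e \<notin> A" "B = insert e A" | "e \<notin> B" "A = insert e B"
proof (cases "e \<in> A")
  case True
  then have "e \<notin> B" "A = insert e B"
    by (simp_all add: sdiff_singletonD[OF assms] set_eq_iff)
  then show ?thesis by (rule that(2))
next
  case False
  then have "B = insert e A"
    by (simp add: sdiff_singletonD[OF assms] set_eq_iff)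
  with False show ?thesis by (rule that(1))
qed

lemma card_sdiff_triangle:
  assumes "finite A" "finite B" "finite C"
  shows "card (sdiff A C) \<le> card (sdiff A B) + card (sdiff B C)"
proof -
  have "sdiff A C \<subseteq> sdiff A B \<union> sdiff B C" by (auto simp: sdiff_def)
  then have "card (sdiff A C) \<le> card (sdiff A B \<union> sdiff B C)"
    using assms by (intro card_mono) (auto simp: sdiff_def)
  also have "\<dots> \<le> card (sdiff A B) + card (sdiff B C)" by (rule card_Un_le)
  finally show ?thesis .
qed

text \<open>The two smaller symmetric differences cover the large one, so the triangle inequality is
  sharp iff they are disjoint, which says that \<open>M\<close> disagrees with \<open>A\<close> and
  \<open>B\<close> only where these disagree with each other.\<close>

lemma card_sdiff_between_iff:
  assumes "finite A" "finite B" "finite M"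
  shows "card (sdiff A M) + card (sdiff M B) = card (sdiff A B) \<longleftrightarrow> A \<inter> B \<subseteq> M \<and> M \<subseteq> A \<union> B"
proof -
  let ?X = "sdiff A M" and ?Y = "sdiff M B"
  have fin: "finite ?X" "finite ?Y" using assms by (auto simp: finite_sdiff)
  have sum: "card ?X + card ?Y = card (?X \<union> ?Y) + card (?X \<inter> ?Y)"
    using fin by (rule card_Un_Int)
  have le: "card (sdiff A B) \<le> card (?X \<union> ?Y)"
    using fin by (intro card_mono) (auto simp: sdiff_def)
  show ?thesis
  proof
    assume "card ?X + card ?Y = card (sdiff A B)"
    then have "card (?X \<inter> ?Y) = 0" using sum le by linarith
    then have "?X \<inter> ?Y = {}" using fin by simp
    then show "A \<inter> B \<subseteq> M \<and> M \<subseteq> A \<union> B" by (auto simp: sdiff_def)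
  next
    assume "A \<inter> B \<subseteq> M \<and> M \<subseteq> A \<union> B"
    then have "?X \<union> ?Y = sdiff A B" "?X \<inter> ?Y = {}" by (auto simp: sdiff_def)
    then show "card ?X + card ?Y = card (sdiff A B)" using sum by simp
  qed
qed

text \<open>Changing the single element \<open>e\<close> changes the distance to \<open>C\<close> by
  exactly one, with a sign that depends only on the side of \<open>e\<close> on which
  \<open>C\<close> lies.\<close>

lemma card_sdiff_toggle:
  assumes "sdiff A B = {e}" "finite A" "finite C"
  shows "(e \<in> C) = (e \<in> A) \<Longrightarrow> card (sdiff B C) = Suc (card (sdiff A C))"
    and "(e \<in> C) \<noteq> (e \<in> A) \<Longrightarrow> card (sdiff A C) = Suc (card (sdiff B C))"
proof -
  have finB: "finite B" using assms by (metis finite.simps finite_Un finite_insert sdiff_singleton_cases)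
  note B = sdiff_singletonD[OF assms(1)]
  { assume "(e \<in> C) = (e \<in> A)"
    then have "sdiff B C = insert e (sdiff A C)" "e \<notin> sdiff A C"
      by (auto simp: sdiff_def B split: if_splits)
    then show "card (sdiff B C) = Suc (card (sdiff A C))"
      using finite_sdiff[OF assms(2,3)] by simp }
  { assume "(e \<in> C) \<noteq> (e \<in> A)"
    then have "sdiff A C = insert e (sdiff B C)" "e \<notin> sdiff B C"
      by (auto simp: sdiff_def B split: if_splits)
    then show "card (sdiff A C) = Suc (card (sdiff B C))"
      using finite_sdiff[OF finB assms(3)] by simp }
qed

text \<open>An infinite set also has subsets of size \<open>Suc n\<close>, so excluding these
  settles finiteness and the bound together.\<close>

lemma finite_card_leI:
  assumes "\<And>T. \<lbrakk>T \<subseteq> A; card T = Suc n\<rbrakk> \<Longrightarrow> False"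
  shows "finite A \<and> card A \<le> n"
proof (rule ccontr)
  assume *: "\<not> (finite A \<and> card A \<le> n)"
  have "\<exists>T\<subseteq>A. card T = Suc n"
  proof (cases "finite A")
    case True
    then show ?thesis using * obtain_subset_with_card_n[of "Suc n" A] by (metis not_less_eq_eq)
  next
    case False
    then show ?thesis using infinite_arbitrarily_large[of A "Suc n"] by blast
  qed
  then show False using assms by blast
qed

subsection \<open>The graph of finite configurations of an event structure\<close>

locale event_structure =
  fixes E :: "'e set" and le conf :: "'e \<Rightarrow> 'e \<Rightarrow> bool"
  assumes le_refl: "e \<in> E \<Longrightarrow> le e e"
    and le_antisym: "\<lbrakk>e \<in> E; f \<in> E; le e f; le f e\<rbrakk> \<Longrightarrow> e = f"
    and le_trans: "\<lbrakk>e \<in> E; f \<in> E; g \<in> E; le e f; le f g\<rbrakk> \<Longrightarrow> le e g"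
    and finite_past: "e \<in> E \<Longrightarrow> finite {f \<in> E. le f e}"
    and conf_irrefl: "e \<in> E \<Longrightarrow> \<not> conf e e"
    and conf_sym: "\<lbrakk>e \<in> E; f \<in> E; conf e f\<rbrakk> \<Longrightarrow> conf f e"
    and conf_le: "\<lbrakk>e \<in> E; f \<in> E; g \<in> E; conf e f; le f g\<rbrakk> \<Longrightarrow> conf e g"
begin

text \<open>Finiteness is imposed because the vertices of the graph are the configurations at finite
  distance from the empty one.\<close>

definition config :: "'e set \<Rightarrow> bool" where
  "config C \<longleftrightarrow> finite C \<and> C \<subseteq> E \<and> (\<forall>e\<in>C. \<forall>f\<in>E. le f e \<longrightarrow> f \<in> C) \<and>
     (\<forall>e\<in>C. \<forall>f\<in>C. \<not> conf e f)"

definition enabled :: "'e set \<Rightarrow> 'e \<Rightarrow> bool" where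
  "enabled C e \<longleftrightarrow> e \<notin> C \<and> config (insert e C)"

definition past :: "'e \<Rightarrow> 'e set" where
  "past e = {f \<in> E. le f e}"

text \<open>Independence in the sense of the paper: the two events are concurrent, or in conflict with
  no conflict inherited from a proper predecessor. Concurrency implies the last two conjuncts.\<close>

definition indep :: "'e \<Rightarrow> 'e \<Rightarrow> bool" where
  "indep e f \<longleftrightarrow> \<not> le e f \<and> \<not> le f e \<and>
     (\<forall>x\<in>E. x \<noteq> e \<longrightarrow> le x e \<longrightarrow> \<not> conf x f) \<and> (\<forall>x\<in>E. x \<noteq> f \<longrightarrow> le x f \<longrightarrow> \<not> conf x e)"

lemma configD:
  assumes "config C"
  shows "finite C" "C \<subseteq> E" "\<And>e f. \<lbrakk>e \<in> C; f \<in> E; le f e\<rbrakk> \<Longrightarrow> f \<in> C"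
    "\<And>e f. \<lbrakk>e \<in> C; f \<in> C\<rbrakk> \<Longrightarrow> \<not> conf e f"
  using assms by (auto simp: config_def)

lemma configI:
  assumes "finite C" "C \<subseteq> E" "\<And>e f. \<lbrakk>e \<in> C; f \<in> E; le f e\<rbrakk> \<Longrightarrow> f \<in> C"
    "\<And>e f. \<lbrakk>e \<in> C; f \<in> C\<rbrakk> \<Longrightarrow> \<not> conf e f"
  shows "config C"
  unfolding config_def using assms(1,2) by (intro conjI ballI impI) (erule (2) assms(3) | erule (1) assms(4) | assumption)+

lemma config_empty: "config {}"
  by (simp add: config_def)

lemma conf_le2: "\<lbrakk>e \<in> E; f \<in> E; x \<in> E; y \<in> E; conf x y; le x e; le y f\<rbrakk> \<Longrightarrow> conf e f"
  by (rule conf_sym, assumption+, rule conf_le[of f x e], assumption+, rule conf_sym,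
      assumption+, rule conf_le[of x y f]) assumption+

text \<open>A strictly larger event has a strictly larger past, so an event of \<open>A\<close> with
  the most predecessors is maximal.\<close>

lemma finite_maximal:
  assumes "finite A" "A \<noteq> {}" "A \<subseteq> E"
  obtains e where "e \<in> A" "\<And>f. f \<in> A \<Longrightarrow> le e f \<Longrightarrow> f = e"
proof -
  have "Max ((\<lambda>e. card (past e)) ` A) \<in> (\<lambda>e. card (past e)) ` A"
    using assms(1,2) by (intro Max_in) auto
  then obtain e where e: "e \<in> A" "card (past e) = Max ((\<lambda>e. card (past e)) ` A)" by auto
  have le_e: "card (past f) \<le> card (past e)" if "f \<in> A" for f
    unfolding e(2) using assms(1) that by simp
  have "f = e" if f: "f \<in> A" "le e f" for f
  proof (rule ccontr)
    assume "f \<noteq> e"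
    have "e \<in> E" "f \<in> E" using e f assms by auto
    moreover have "f \<notin> past e"
      using \<open>f \<noteq> e\<close> f calculation le_antisym by (auto simp: past_def)
    moreover have "f \<in> past f" "past e \<subseteq> past f"
      using calculation f le_refl[of f] le_trans[of _ e f] by (auto simp: past_def)
    ultimately have "past e \<subset> past f" "finite (past f)"
      using finite_past by (auto simp: past_def)
    then have "card (past e) < card (past f)" by (rule psubset_card_mono[rotated])
    then show False using le_e[of f] f by simp
  qed
  then show ?thesis using e that by blast
qed

text \<open>The finite set \<open>A\<close> with the reversed order and no conflicts is again an
  event structure, which dualises the existence of maximal elements.\<close>

lemma finite_minimal:
  assumes "finite A" "A \<noteq> {}" "A \<subseteq> E"
  obtains e where "e \<in> A" "\<And>f. f \<in> A \<Longrightarrow> le f e \<Longrightarrow> f = e"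
proof -
  interpret dual: event_structure A "\<lambda>e f. le f e" "\<lambda>_ _. False"
  proof
    fix e f g assume "e \<in> A" "f \<in> A" "g \<in> A" "le f e" "le g f"
    then show "le g e" using le_trans[of g f e] assms by blast
  next
    fix e f assume "e \<in> A" "f \<in> A" "le f e" "le e f"
    then show "e = f" using le_antisym[of e f] assms by blast
  qed (use assms le_refl in auto)
  show ?thesis using dual.finite_maximal[of A] assms that by blast
qed

lemma config_past: "e \<in> E \<Longrightarrow> config (past e)"
proof -
  assume e: "e \<in> E"
  have "\<not> conf x y" if "x \<in> past e" "y \<in> past e" for x y
    using conf_le2[of e e x y] conf_irrefl[of e] that e by (auto simp: past_def)
  moreover have "y \<in> past e" if "x \<in> past e" "y \<in> E" "le y x" for x y
    using le_trans[of y x e] that e by (auto simp: past_def)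
  ultimately show ?thesis
    using finite_past[OF e] by (auto simp: config_def past_def)
qed

text \<open>This provides, for every event, an edge of the configuration graph that adds it.\<close>

lemma enabled_past:
  assumes e: "e \<in> E"
  shows "config (past e - {e})" "enabled (past e - {e}) e"
proof -
  have self: "e \<in> past e" using le_refl[OF e] e by (auto simp: past_def)
  note pe = configD[OF config_past[OF e]]
  have "y \<noteq> e" if "x \<in> past e - {e}" "le y x" for x y
    using that le_antisym[of x e] e by (auto simp: past_def)
  then show "config (past e - {e})"
    unfolding config_def using pe by (intro conjI ballI impI) auto
  show "enabled (past e - {e}) e"
    using self config_past[OF e] by (simp add: enabled_def insert_absorb)
qed

text \<open>Every proper predecessor of \<open>e\<close> already lies in \<open>C\<close>, and
  nothing in \<open>C\<close> conflicts with \<open>f\<close>. Together with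
  \<open>indep_enabled\<close> this identifies independence with being enabled at a common
  configuration.\<close>

lemma enabled_indep:
  assumes "config C" "enabled C e" "enabled C f" "e \<noteq> f"
  shows "indep e f"
proof -
  have e: "e \<in> E" "e \<notin> C" "\<And>x. x \<in> E \<Longrightarrow> le x e \<Longrightarrow> x \<noteq> e \<Longrightarrow> x \<in> C" "\<And>x. x \<in> C \<Longrightarrow> \<not> conf x e"
    using assms(2) by (auto simp: enabled_def config_def)
  have f: "f \<in> E" "f \<notin> C" "\<And>x. x \<in> E \<Longrightarrow> le x f \<Longrightarrow> x \<noteq> f \<Longrightarrow> x \<in> C" "\<And>x. x \<in> C \<Longrightarrow> \<not> conf x f"
    using assms(3) by (auto simp: enabled_def config_def)
  show ?thesis using e f assms(4) unfolding indep_def by auto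
qed

lemma enabled_pairwise_indep:
  "config C \<Longrightarrow> pairwise indep {e. enabled C e}"
  by (simp add: pairwise_def enabled_indep)

lemma enabled_subset: "{e. enabled C e} \<subseteq> E"
  by (auto simp: enabled_def config_def)

lemma indep_enabled:
  assumes "e \<in> E" "f \<in> E" "indep e f"
  obtains C where "config C" "enabled C e" "enabled C f" "\<not> conf e f \<Longrightarrow> config (insert e (insert f C))"
proof
  \<comment> \<open>The least possible choice: all proper predecessors of both events. Independence
    forbids exactly the inherited conflicts that could spoil it.\<close>
  define C where "C = past e \<union> past f - {e, f}"
  have ne: "e \<noteq> f" using assms le_refl by (auto simp: indep_def)
  have fin: "finite (past e \<union> past f)" using finite_past assms by (auto simp: past_def)
  note pe = configD[OF config_past[OF assms(1)]] and pf = configD[OF config_past[OF assms(2)]]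
  have self: "e \<in> past e" "f \<in> past f" "e \<notin> past f" "f \<notin> past e"
    using assms le_refl by (auto simp: past_def indep_def)
  have nc: "\<not> conf x f \<and> \<not> conf f x" if "x \<in> past e" "x \<noteq> e" for x
    using that assms conf_sym[of f x] by (auto simp: indep_def past_def)
  have nc': "\<not> conf x e \<and> \<not> conf e x" if "x \<in> past f" "x \<noteq> f" for x
    using that assms conf_sym[of e x] by (auto simp: indep_def past_def)
  have ncef: "\<not> conf x y \<and> \<not> conf y x" if "x \<in> past e" "x \<noteq> e" "y \<in> past f" for x y
    using that nc[of x] conf_le[of x y f] conf_sym[of y x] assms
    by (auto simp: past_def)
  have down: "y \<in> past e \<union> past f" if "x \<in> past e \<union> past f" "y \<in> E" "le y x" for x y
    using that pe(3)[of x y] pf(3)[of x y] by auto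
  have downe: "y \<noteq> e" if "x \<in> past e \<union> past f - {e}" "le y x" for x y
    using that self le_antisym[of x e] pf(3)[of x e] assms by (auto simp: past_def)
  have downf: "y \<noteq> f" if "x \<in> past e \<union> past f - {f}" "le y x" for x y
    using that self le_antisym[of x f] pe(3)[of x f] assms by (auto simp: past_def)
  have sub: "past e \<union> past f \<subseteq> E" by (auto simp: past_def)
  have C1: "\<not> conf x y" if "x \<in> C" "y \<in> C" for x y
    using that pe(4)[of x y] pf(4)[of x y] ncef[of x y] ncef[of y x] unfolding C_def by auto
  have C2: "\<not> conf x e \<and> \<not> conf e x \<and> \<not> conf x f \<and> \<not> conf f x" if "x \<in> C" for x
    using that pe(4)[of x e] pe(4)[of e x] pf(4)[of x f] pf(4)[of f x] nc[of x] nc'[of x] self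
    unfolding C_def by auto
  have irr: "\<not> conf e e" "\<not> conf f f" using assms conf_irrefl by auto
  have i1: "insert e C = past e \<union> past f - {f}" "insert f C = past e \<union> past f - {e}"
    "insert e (insert f C) = past e \<union> past f"
    using self ne unfolding C_def by blast+
  have down0: "y \<in> C" if "x \<in> C" "y \<in> E" "le y x" for x y
    using that down[of x y] downe[of x y] downf[of x y] unfolding C_def by auto
  have downE: "y \<in> insert e C" if "x \<in> insert e C" "y \<in> E" "le y x" for x y
    using that down[of x y] downf[of x y] unfolding i1 by auto
  have downF: "y \<in> insert f C" if "x \<in> insert f C" "y \<in> E" "le y x" for x y
    using that down[of x y] downe[of x y] unfolding i1 by auto
  have finC: "finite C" and subC: "C \<subseteq> E" using fin sub by (auto simp: C_def)
  show "config C" using finC subC down0 C1 by (rule configI)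
  have confE: "\<not> conf x y" if "x \<in> insert e C" "y \<in> insert e C" for x y
    using that C1[of x y] C2[of x] C2[of y] irr by auto
  have confF: "\<not> conf x y" if "x \<in> insert f C" "y \<in> insert f C" for x y
    using that C1[of x y] C2[of x] C2[of y] irr by auto
  have "config (insert e C)"
    by (rule configI[OF _ _ downE confE]) (use finC subC assms in auto)
  moreover have "config (insert f C)"
    by (rule configI[OF _ _ downF confF]) (use finC subC assms in auto)
  ultimately show "enabled C e" "enabled C f"
    by (auto simp: C_def enabled_def)
  assume nef: "\<not> conf e f"
  then have "\<not> conf f e" using assms conf_sym by blast
  with nef have confEF: "\<not> conf x y"
    if "x \<in> insert e (insert f C)" "y \<in> insert e (insert f C)" for x y
    using that C1[of x y] C2[of x] C2[of y] irr by auto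
  have downEF: "y \<in> insert e (insert f C)" if "x \<in> insert e (insert f C)" "y \<in> E" "le y x" for x y
    using that down[of x y] self unfolding i1 by auto
  show "config (insert e (insert f C))"
    by (rule configI[OF _ _ downEF confEF]) (use finC subC assms in auto)
qed

text \<open>Two elements that each belong to at least two of the three sets belong together to one
  of them, and there they do not conflict.\<close>

lemma config_majority:
  assumes "config A" "config B" "config C"
  shows "config ((A \<inter> B) \<union> (B \<inter> C) \<union> (C \<inter> A))"
  unfolding config_def
proof (intro conjI ballI impI)
  show "finite (A \<inter> B \<union> B \<inter> C \<union> C \<inter> A)" "A \<inter> B \<union> B \<inter> C \<union> C \<inter> A \<subseteq> E"
    using assms by (auto simp: config_def)
next
  fix e f assume "e \<in> A \<inter> B \<union> B \<inter> C \<union> C \<inter> A" "f \<in> E" "le f e"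
  then show "f \<in> A \<inter> B \<union> B \<inter> C \<union> C \<inter> A"
    using configD(3)[OF assms(1), of e f] configD(3)[OF assms(2), of e f]
      configD(3)[OF assms(3), of e f] by blast
next
  fix e f assume "e \<in> A \<inter> B \<union> B \<inter> C \<union> C \<inter> A" "f \<in> A \<inter> B \<union> B \<inter> C \<union> C \<inter> A"
  then show "\<not> conf e f"
    using configD(4)[OF assms(1), of e f] configD(4)[OF assms(2), of e f]
      configD(4)[OF assms(3), of e f] by blast
qed

text \<open>A maximal event \<open>e\<close> of \<open>A - B\<close> is maximal in \<open>A\<close>:
  an event of \<open>A\<close> above it cannot lie in \<open>B\<close>, since \<open>B\<close> is
  downward closed and misses \<open>e\<close>.\<close>

lemma config_remove:
  assumes "config A" "config B" "\<not> A \<subseteq> B"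
  obtains e where "e \<in> A - B" "config (A - {e})"
proof -
  have fin: "finite (A - B)" "A - B \<noteq> {}" "A - B \<subseteq> E"
    using assms by (auto simp: config_def)
  obtain e where e: "e \<in> A - B" "\<And>f. f \<in> A - B \<Longrightarrow> le e f \<Longrightarrow> f = e"
    using finite_maximal[OF fin] by blast
  have "config (A - {e})"
    unfolding config_def
  proof (intro conjI ballI impI)
    show "finite (A - {e})" "A - {e} \<subseteq> E" using assms(1) by (auto simp: config_def)
  next
    fix x y assume "x \<in> A - {e}" "y \<in> E" "le y x"
    then show "y \<in> A - {e}"
      using configD(3)[OF assms(1), of x y] configD(3)[OF assms(2), of x y] e(1) e(2)[of x] by blast
  next
    fix x y assume "x \<in> A - {e}" "y \<in> A - {e}"
    then show "\<not> conf x y" using configD(4)[OF assms(1)] by blast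
  qed
  then show ?thesis using that e by blast
qed

lemma config_add:
  assumes "config A" "config B" "A \<subset> B"
  obtains e where "e \<in> B - A" "config (insert e A)"
proof -
  have fin: "finite (B - A)" "B - A \<noteq> {}" "B - A \<subseteq> E"
    using assms by (auto simp: config_def)
  obtain e where e: "e \<in> B - A" "\<And>f. f \<in> B - A \<Longrightarrow> le f e \<Longrightarrow> f = e"
    using finite_minimal[OF fin] by blast
  have "config (insert e A)"
  proof -
    have "finite (insert e A)" "insert e A \<subseteq> E" using assms e by (auto simp: config_def)
    moreover have "y \<in> insert e A" if "x \<in> insert e A" "y \<in> E" "le y x" for x y
      using configD(3)[OF assms(1), of x y] configD(3)[OF assms(2), of x y] e(1) e(2)[of y] that by blast
    moreover have "\<not> conf x y" if "x \<in> insert e A" "y \<in> insert e A" for x y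
      using configD(4)[OF assms(2), of x y] that assms(3) e(1) by blast
    ultimately show ?thesis unfolding config_def by blast
  qed
  then show ?thesis using that e by blast
qed

end

section \<open>The configuration graph: distances, intervals, medians\<close>

lemma gpath_Cons_Cons:
  "gpath V Adj (a # b # p) \<longleftrightarrow> a \<in> V \<and> Adj a b \<and> gpath V Adj (b # p)"
  unfolding gpath_def by (auto simp: nth_Cons split: nat.splits)

text \<open>Vertices are names for configurations, decoded by \<open>S\<close>, because the graph is
  finally to live on the natural numbers.\<close>

locale config_graph = event_structure E le conf
  for E :: "'e set" and le conf :: "'e \<Rightarrow> 'e \<Rightarrow> bool" +
  fixes V :: "'v set" and S :: "'v \<Rightarrow> 'e set"
  assumes bij_S: "bij_betw S V {C. config C}"
begin

definition Adj :: "'v \<Rightarrow> 'v \<Rightarrow> bool" where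
  "Adj x y \<longleftrightarrow> x \<in> V \<and> y \<in> V \<and> card (sdiff (S x) (S y)) = 1"

definition code :: "'e set \<Rightarrow> 'v" where
  "code = the_inv_into V S"

definition cls :: "'e \<Rightarrow> ('v \<times> 'v) set" where
  "cls e = {(x, y). x \<in> V \<and> y \<in> V \<and> sdiff (S x) (S y) = {e}}"

lemma config_S: "x \<in> V \<Longrightarrow> config (S x)"
  using bij_S by (auto simp: bij_betw_def)

lemma finite_S: "x \<in> V \<Longrightarrow> finite (S x)"
  using config_S configD(1) by blast

lemma S_inject: "\<lbrakk>x \<in> V; y \<in> V\<rbrakk> \<Longrightarrow> S x = S y \<longleftrightarrow> x = y"
  using bij_S by (auto simp: bij_betw_def inj_on_def)

lemma code_in: "config C \<Longrightarrow> code C \<in> V"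
  unfolding code_def using bij_S by (intro the_inv_into_into) (auto simp: bij_betw_def)

lemma S_code: "config C \<Longrightarrow> S (code C) = C"
  unfolding code_def using bij_S by (intro f_the_inv_into_f) (auto simp: bij_betw_def)

lemma code_S: "x \<in> V \<Longrightarrow> code (S x) = x"
  unfolding code_def using bij_S by (intro the_inv_into_f_f) (auto simp: bij_betw_def)

lemma Adj_cls: "Adj x y \<longleftrightarrow> (\<exists>e. (x, y) \<in> cls e)"
  by (auto simp: Adj_def cls_def card_1_singleton_iff)

lemma cls_sym: "(x, y) \<in> cls e \<Longrightarrow> (y, x) \<in> cls e"
  by (auto simp: cls_def sdiff_commute)

lemma cls_V: "(x, y) \<in> cls e \<Longrightarrow> x \<in> V \<and> y \<in> V"
  by (simp add: cls_def)

lemma cls_E: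
  assumes "(x, y) \<in> cls e"
  shows "e \<in> E"
proof -
  have "e \<in> sdiff (S x) (S y)" "x \<in> V" "y \<in> V" using assms by (auto simp: cls_def)
  then have "e \<in> S x \<or> e \<in> S y" by (auto simp: sdiff_def)
  then show ?thesis using configD(2)[OF config_S] \<open>x \<in> V\<close> \<open>y \<in> V\<close> by blast
qed

lemma cls_mem:
  assumes "(x, y) \<in> cls e"
  shows "f \<in> S y \<longleftrightarrow> (if f = e then f \<notin> S x else f \<in> S x)"
  using assms sdiff_singletonD[of "S x" "S y" e f] by (simp add: cls_def)

lemma cls_enabled:
  assumes "config C" "enabled C e"
  shows "(code C, code (insert e C)) \<in> cls e"
  using assms by (auto simp: cls_def enabled_def code_in S_code sdiff_insert)

lemma cls_unique: "\<lbrakk>(x, y) \<in> cls e; (x, y) \<in> cls f\<rbrakk> \<Longrightarrow> e = f"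
  by (simp add: cls_def)

lemma cls_inj: "inj_on cls E"
proof (rule inj_onI)
  fix e f assume "e \<in> E" "cls e = cls f"
  then show "e = f"
    using cls_enabled[OF enabled_past[OF \<open>e \<in> E\<close>]] cls_unique by metis
qed

lemma path_length_ge:
  "\<lbrakk>gpath V Adj p; last p = y; y \<in> V\<rbrakk> \<Longrightarrow> card (sdiff (S (hd p)) (S y)) < length p"
proof (induction p rule: induct_list012)
  case 1
  then show ?case by (simp add: gpath_def)
next
  case (2 x)
  then show ?case by (simp add: sdiff_def)
next
  case (3 a b p)
  then have "Adj a b" and *: "gpath V Adj (b # p)"
    by (simp_all add: gpath_Cons_Cons)
  then have "a \<in> V" "b \<in> V" "card (sdiff (S a) (S b)) = 1"
    by (simp_all add: Adj_def)
  moreover have "card (sdiff (S b) (S y)) < length (b # p)" using 3 * by simp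
  ultimately show ?case
    using card_sdiff_triangle[of "S a" "S b" "S y"] finite_S 3(5) by simp
qed

lemma step_towards:
  assumes "x \<in> V" "y \<in> V" "x \<noteq> y"
  obtains z where "Adj x z" "card (sdiff (S x) (S y)) = Suc (card (sdiff (S z) (S y)))"
proof -
  have c: "config (S x)" "config (S y)" using assms config_S by auto
  obtain C e where C: "config C" "sdiff (S x) C = {e}" "(e \<in> S y) \<noteq> (e \<in> S x)"
  proof (cases "S x \<subseteq> S y")
    case True
    then have "S x \<subset> S y" using assms S_inject by blast
    from config_add[OF c this] obtain e where "e \<in> S y - S x" "config (insert e (S x))" by blast
    then show ?thesis using that[of "insert e (S x)" e] by (auto simp: sdiff_def)
  next
    case False
    from config_remove[OF c this] obtain e where "e \<in> S x - S y" "config (S x - {e})" by blast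
    then show ?thesis using that[of "S x - {e}" e] by (auto simp: sdiff_def)
  qed
  have "Adj x (code C)" using C assms by (simp add: Adj_def code_in S_code)
  moreover have "card (sdiff (S x) (S y)) = Suc (card (sdiff (S (code C)) (S y)))"
    using card_sdiff_toggle(2)[OF C(2)] C(1,3) finite_S assms by (simp add: S_code)
  ultimately show ?thesis using that by blast
qed

lemma path_exists:
  "\<lbrakk>x \<in> V; y \<in> V\<rbrakk> \<Longrightarrow>
     \<exists>p. gpath V Adj p \<and> hd p = x \<and> last p = y \<and> length p = Suc (card (sdiff (S x) (S y)))"
proof (induction "card (sdiff (S x) (S y))" arbitrary: x)
  case 0
  then have "sdiff (S x) (S y) = {}" using finite_S finite_sdiff by (metis card_0_eq)
  then have "x = y" using 0 S_inject by (simp add: sdiff_empty_iff)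
  then show ?case using 0 by (intro exI[of _ "[x]"]) (simp add: gpath_def)
next
  case (Suc n)
  then have "x \<noteq> y" by (auto simp: sdiff_def)
  with Suc.prems obtain z where z: "Adj x z" "card (sdiff (S x) (S y)) = Suc (card (sdiff (S z) (S y)))"
    by (rule step_towards)
  then obtain p where p: "gpath V Adj p" "hd p = z" "last p = y" "length p = Suc n"
    using Suc.hyps(1)[of z] Suc.hyps(2) Suc.prems by (auto simp: Adj_def)
  then obtain q where "p = z # q" by (cases p) (auto simp: gpath_def)
  then show ?case
    using p z Suc.hyps(2) Suc.prems by (intro exI[of _ "x # p"]) (auto simp: gpath_Cons_Cons)
qed

lemma gdist_eq:
  assumes "x \<in> V" "y \<in> V"
  shows "gdist V Adj x y = card (sdiff (S x) (S y))"
  unfolding gdist_def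
proof (rule Least_equality)
  show "\<exists>p. gpath V Adj p \<and> hd p = x \<and> last p = y \<and> length p = Suc (card (sdiff (S x) (S y)))"
    by (rule path_exists[OF assms])
next
  fix n assume "\<exists>p. gpath V Adj p \<and> hd p = x \<and> last p = y \<and> length p = Suc n"
  then show "card (sdiff (S x) (S y)) \<le> n" using path_length_ge[of _ y] assms(2) by force
qed

lemma simple_graph: "simple_graph V Adj"
  by (auto simp: simple_graph_def Adj_def sdiff_commute) (simp add: sdiff_def)

lemma connected_graph: "connected_graph V Adj"
  using path_exists by (fastforce simp: connected_graph_def)

lemma interval_eq:
  assumes "x \<in> V" "y \<in> V"
  shows "interval V Adj x y = {m \<in> V. S x \<inter> S y \<subseteq> S m \<and> S m \<subseteq> S x \<union> S y}"
  using assms card_sdiff_between_iff[of "S x" "S y"] finite_S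
  by (auto simp: interval_def gdist_eq)

lemma median_graph: "median_graph V Adj"
  unfolding median_graph_def
proof (intro conjI ballI simple_graph connected_graph)
  fix x y z assume V: "x \<in> V" "y \<in> V" "z \<in> V"
  define M where "M = (S x \<inter> S y) \<union> (S y \<inter> S z) \<union> (S z \<inter> S x)"
  have M: "config M" unfolding M_def by (intro config_majority config_S V)
  \<comment> \<open>The lower bounds have union \<open>M\<close> and the upper bounds have
    intersection \<open>M\<close>: the union of the pairwise intersections of three sets equals the
    intersection of their pairwise unions.\<close>
  have "m \<in> interval V Adj x y \<inter> interval V Adj y z \<inter> interval V Adj z x \<longleftrightarrow> m \<in> V \<and> S m = M" for m
    unfolding interval_eq[OF V(1,2)] interval_eq[OF V(2,3)] interval_eq[OF V(3,1)] M_def by blast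
  then show "\<exists>!m. m \<in> interval V Adj x y \<inter> interval V Adj y z \<inter> interval V Adj z x"
    using M code_in[OF M] S_code[OF M] S_inject by metis
qed

section \<open>The classes of the Djokovic-Winkler relation and their halfspaces\<close>

text \<open>The distances from \<open>z\<close> to \<open>x\<close> and \<open>y\<close> differ by
  one, with a sign given by the side of \<open>e\<close> containing \<open>z\<close>; likewise for
  \<open>w\<close>. The two sums differ iff \<open>z\<close> and \<open>w\<close> lie on different
  sides of \<open>e\<close>, and the edge from \<open>z\<close> to \<open>w\<close> changes sides of
  \<open>f\<close> only.\<close>

lemma theta_iff:
  assumes xy: "(x, y) \<in> cls e" and zw: "(z, w) \<in> cls f"
  shows "theta V Adj (x, y) (z, w) \<longleftrightarrow> e = f"
proof -
  have V: "x \<in> V" "y \<in> V" "z \<in> V" "w \<in> V" using assms by (auto simp: cls_def)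
  have s: "sdiff (S x) (S y) = {e}" using xy by (simp add: cls_def)
  note t = card_sdiff_toggle[OF s finite_S[OF V(1)]]
  have "e = f \<longleftrightarrow> (e \<in> S z) \<noteq> (e \<in> S w)" using cls_mem[OF zw, of e] by auto
  moreover have "card (sdiff (S x) (S z)) + card (sdiff (S y) (S w)) \<noteq>
      card (sdiff (S x) (S w)) + card (sdiff (S y) (S z)) \<longleftrightarrow> (e \<in> S z) \<noteq> (e \<in> S w)"
    using t(1)[OF finite_S[OF V(3)]] t(2)[OF finite_S[OF V(3)]]
      t(1)[OF finite_S[OF V(4)]] t(2)[OF finite_S[OF V(4)]] by fastforce
  ultimately show ?thesis using V by (simp add: theta_def gdist_eq)
qed

lemma theta_classes_eq: "theta_classes V Adj = cls ` E"
proof -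
  have *: "{g \<in> gedges V Adj. theta V Adj (x, y) g} = cls e" if "(x, y) \<in> cls e" for x y e
    using theta_iff[OF that] Adj_cls by (fastforce simp: gedges_def)
  show ?thesis
  proof (intro equalityI subsetI)
    fix c assume "c \<in> theta_classes V Adj"
    then obtain x y where "Adj x y" "c = {g \<in> gedges V Adj. theta V Adj (x, y) g}"
      by (auto simp: theta_classes_def gedges_def)
    then show "c \<in> cls ` E" using * Adj_cls cls_E by blast
  next
    fix c assume "c \<in> cls ` E"
    then obtain e where e: "e \<in> E" "c = cls e" by blast
    obtain x y where xy: "(x, y) \<in> cls e" using cls_enabled[OF enabled_past[OF e(1)]] by blast
    then have "(x, y) \<in> gedges V Adj" using Adj_cls by (auto simp: gedges_def)
    then show "c \<in> theta_classes V Adj" using *[OF xy] e unfolding theta_classes_def by blast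
  qed
qed

abbreviation origin :: 'v where
  "origin \<equiv> code {}"

lemma gdist_origin:
  assumes "x \<in> V"
  shows "gdist V Adj x origin = card (S x)" "gdist V Adj origin x = card (S x)"
  using assms by (simp_all add: gdist_eq code_in config_empty S_code sdiff_def)

lemma cls_oriented:
  assumes "(x, y) \<in> cls e"
  shows "card (S x) < card (S y) \<longleftrightarrow> e \<notin> S x"
proof -
  have V: "x \<in> V" "y \<in> V" using cls_V[OF assms] by auto
  have s: "sdiff (S x) (S y) = {e}" using assms by (simp add: cls_def)
  show ?thesis
    using card_sdiff_toggle[OF s finite_S[OF V(1)], of "{}"] by (auto simp: sdiff_def)
qed

lemma far_half_eq:
  assumes "e \<in> E"
  shows "far_half V Adj origin (cls e) = {z \<in> V. e \<in> S z}"
proof -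
  have *: "gdist V Adj z y < gdist V Adj z x \<longleftrightarrow> e \<in> S z"
    if "z \<in> V" "(x, y) \<in> cls e" "e \<notin> S x" for x y z
  proof -
    have V: "x \<in> V" "y \<in> V" using cls_V[OF that(2)] by auto
    have s: "sdiff (S x) (S y) = {e}" using that by (simp add: cls_def)
    show ?thesis
      using card_sdiff_toggle[OF s finite_S[OF V(1)] finite_S[OF that(1)]] that V
      by (cases "e \<in> S z") (auto simp: gdist_eq sdiff_commute)
  qed
  obtain x y where "(x, y) \<in> cls e" "e \<notin> S x"
    using cls_enabled[OF enabled_past[OF assms]] S_code[OF enabled_past(1)[OF assms]] by blast
  then show ?thesis
    using * cls_oriented cls_V unfolding far_half_def
    by (auto simp: gdist_origin; metis gdist_origin(2))
qed

section \<open>Crossing, separation, conflict and independence of classes\<close>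

lemma conf_incomparable:
  assumes "e \<in> E" "f \<in> E" "conf e f"
  shows "e \<noteq> f" "\<not> le e f" "\<not> le f e"
  using assms conf_le[of f e f] conf_le[of e f e] conf_sym[of e f] conf_irrefl by blast+

text \<open>The corners of the 4-cycle realise all patterns of membership of \<open>e\<close> and
  \<open>f\<close>: one without the other refutes each comparability, both together refute the
  conflict.\<close>

lemma crossesD:
  assumes "crosses V Adj (cls e) (cls f)"
  shows "e \<noteq> f" "\<not> le e f" "\<not> le f e" "\<not> conf e f"
proof -
  obtain a b c d where cyc: "distinct [a, b, c, d]"
    and ab: "(a, b) \<in> cls e" and cd: "(c, d) \<in> cls e" and bc: "(b, c) \<in> cls f" and da: "(d, a) \<in> cls f"
    using assms unfolding crosses_def cycle4_def by blast
  have V: "a \<in> V" "b \<in> V" "c \<in> V" "d \<in> V" using cls_V ab cd by blast+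
  have E: "e \<in> E" "f \<in> E" using cls_E ab bc by auto
  show ne: "e \<noteq> f"
  proof
    assume "e = f"
    then have "S a = S c" by (simp add: cls_mem[OF bc] cls_mem[OF ab] set_eq_iff)
    then show False using cyc V S_inject[of a c] by simp
  qed
  have mem: "e \<in> S b \<longleftrightarrow> e \<notin> S a" "f \<in> S b \<longleftrightarrow> f \<in> S a" "e \<in> S c \<longleftrightarrow> e \<notin> S a" "f \<in> S c \<longleftrightarrow> f \<notin> S a"
    "e \<in> S d \<longleftrightarrow> e \<in> S a" "f \<in> S d \<longleftrightarrow> f \<notin> S a"
    using ne by (simp_all add: cls_mem[OF bc] cls_mem[OF ab] cls_mem[OF cls_sym[OF da]])
  have "\<exists>x\<in>V. e \<in> S x \<and> f \<notin> S x" "\<exists>x\<in>V. e \<notin> S x \<and> f \<in> S x" "\<exists>x\<in>V. e \<in> S x \<and> f \<in> S x"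
    using mem V by metis+
  then obtain x y z where x: "x \<in> V" "e \<in> S x" "f \<notin> S x" and y: "y \<in> V" "e \<notin> S y" "f \<in> S y"
    and z: "z \<in> V" "e \<in> S z" "f \<in> S z" by blast
  show "\<not> le e f" using configD(3)[OF config_S[OF y(1)], of f e] y E by blast
  show "\<not> le f e" using configD(3)[OF config_S[OF x(1)], of e f] x E by blast
  show "\<not> conf e f" using configD(4)[OF config_S[OF z(1)]] z by blast
qed

text \<open>Concurrent events are independent, hence both enabled at some \<open>C\<close>, and
  adding them in either order closes a 4-cycle.\<close>

lemma crosses_iff:
  assumes "e \<in> E" "f \<in> E"
  shows "crosses V Adj (cls e) (cls f) \<longleftrightarrow> \<not> le e f \<and> \<not> le f e \<and> \<not> conf e f"
proof
  assume *: "\<not> le e f \<and> \<not> le f e \<and> \<not> conf e f"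
  then have ne: "e \<noteq> f" using le_refl assms by auto
  have "indep e f"
    unfolding indep_def
    using * assms conf_sym[of e f] conf_sym[of f e] conf_le[of f _ e] conf_le[of e _ f] conf_sym by blast
  then obtain C where C: "config C" "enabled C e" "enabled C f" "config (insert e (insert f C))"
    using indep_enabled[OF assms] * by blast
  let ?a = "code C" and ?b = "code (insert e C)" and ?c = "code (insert e (insert f C))"
    and ?d = "code (insert f C)"
  have n: "e \<notin> C" "f \<notin> C" and cf: "config (insert e C)" "config (insert f C)"
    using C by (auto simp: enabled_def)
  have "enabled (insert e C) f" "enabled (insert f C) e"
    using C ne n by (auto simp: enabled_def insert_commute)
  then have bc: "(?b, ?c) \<in> cls f" and dc: "(?d, ?c) \<in> cls e"
    using cls_enabled[OF cf(1)] cls_enabled[OF cf(2)] insert_commute[of e f C] by metis+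
  have ab: "(?a, ?b) \<in> cls e" and ad: "(?a, ?d) \<in> cls f"
    using C cls_enabled by auto
  have "distinct [C, insert e C, insert e (insert f C), insert f C]"
    using n ne by auto
  then have "distinct (map S [?a, ?b, ?c, ?d])"
    by (simp only: list.map S_code[OF C(1)] S_code[OF cf(1)] S_code[OF C(4)] S_code[OF cf(2)])
  then have "distinct [?a, ?b, ?c, ?d]" by (simp only: distinct_map)
  then show "crosses V Adj (cls e) (cls f)"
    using ab bc cls_sym[OF dc] cls_sym[OF ad] Adj_cls unfolding crosses_def cycle4_def by blast
qed (use crossesD in blast)

lemma separates_iff:
  assumes "e \<in> E" "f \<in> E"
  shows "separates V Adj origin (cls e) (cls f) \<longleftrightarrow> e \<noteq> f \<and> le e f"
proof
  assume "separates V Adj origin (cls e) (cls f)"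
  \<comment> \<open>A test edge: its tail is the proper past of \<open>f\<close>, which lies beyond
    \<open>e\<close> only if it contains \<open>e\<close>.\<close>
  moreover have "(code (past f - {f}), code (insert f (past f - {f}))) \<in> cls f"
    using cls_enabled enabled_past assms by blast
  ultimately have "code (past f - {f}) \<in> far_half V Adj origin (cls e)"
    by (auto simp: separates_def)
  then show "e \<noteq> f \<and> le e f"
    using assms enabled_past(1)[OF assms(2)] by (simp add: far_half_eq S_code past_def)
next
  assume *: "e \<noteq> f \<and> le e f"
  then have "\<not> crosses V Adj (cls e) (cls f)" using crosses_iff assms by blast
  moreover have "e \<in> S x \<and> e \<in> S y" if xy: "(x, y) \<in> cls f" for x y
  proof -
    have "f \<in> S x \<or> f \<in> S y" using cls_mem[OF xy, of f] by auto
    then have "e \<in> S x \<or> e \<in> S y"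
      using configD(3)[OF config_S] cls_V[OF xy] * assms by blast
    then show ?thesis using cls_mem[OF xy, of e] * by auto
  qed
  ultimately show "separates V Adj origin (cls e) (cls f)"
    using cls_V assms by (auto simp: separates_def compatible_def far_half_eq)
qed

lemma ev_le_iff:
  assumes "e \<in> E" "f \<in> E"
  shows "ev_le V Adj origin (cls e) (cls f) \<longleftrightarrow> le e f"
  using assms separates_iff[OF assms] inj_on_eq_iff[OF cls_inj assms] le_refl[of f]
  by (auto simp: ev_le_def)

lemma ev_conflict_iff:
  assumes "e \<in> E" "f \<in> E"
  shows "ev_conflict V Adj origin (cls e) (cls f) \<longleftrightarrow> conf e f"
  using separates_iff[OF assms] separates_iff[OF assms(2,1)] inj_on_eq_iff[OF cls_inj assms]
    crosses_iff[OF assms] conf_incomparable[OF assms] le_refl[OF assms(1)]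
  unfolding ev_conflict_def compatible_def by blast

text \<open>A conflict between \<open>f\<close> and a predecessor of \<open>e\<close> passes up to
  \<open>e\<close>. So without a conflict of \<open>e\<close> and \<open>f\<close> the conditions on
  predecessors hold by themselves, and with one they express minimality.\<close>

lemma ev_independent_iff:
  assumes "e \<in> E" "f \<in> E"
  shows "ev_independent V Adj origin (cls e) (cls f) \<longleftrightarrow> indep e f"
proof -
  have "ev_concurrent V Adj origin (cls e) (cls f) \<longleftrightarrow> \<not> le e f \<and> \<not> le f e \<and> \<not> conf e f"
    using assms by (simp add: ev_concurrent_def ev_le_iff ev_conflict_iff)
  moreover have "ev_min_conflict V Adj origin (cls e) (cls f) \<longleftrightarrow> conf e f \<and>
      \<not> (\<exists>x\<in>E. x \<noteq> e \<and> x \<noteq> f \<and> (le x e \<and> conf x f \<or> le x f \<and> conf x e))"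
    using assms cls_inj
    by (auto simp: ev_min_conflict_def theta_classes_eq ev_le_iff ev_conflict_iff inj_on_eq_iff)
  moreover have "conf e f" if "x \<in> E" "le x e" "conf x f" for x
    using that conf_le2[of e f x f] le_refl assms by blast
  moreover have "conf e f" if "x \<in> E" "le x f" "conf x e" for x
    using that conf_le2[of f e x e] conf_sym[of f e] le_refl assms by blast
  ultimately show ?thesis
    unfolding ev_independent_def indep_def
    using conf_incomparable[OF assms] conf_irrefl assms by metis
qed

text \<open>Without a conflict the classes cross. Otherwise two edges leave a common configuration,
  and a 4-cycle through both would contain a configuration holding both conflicting events.\<close>

lemma indep_contact_adj:
  assumes "e \<in> E" "f \<in> E" "indep e f"
  shows "contact_adj V Adj origin (cls e) (cls f)"
proof -
  have ne: "e \<noteq> f" using assms le_refl by (auto simp: indep_def)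
  then have "cls e \<noteq> cls f" using assms cls_inj by (auto simp: inj_on_def)
  moreover have "\<exists>x y y'. (x, y) \<in> cls e \<and> (x, y') \<in> cls f \<and>
         gdist V Adj x origin < gdist V Adj y origin \<and> gdist V Adj x origin < gdist V Adj y' origin \<and>
         \<not> in_common_c4 Adj (x, y) (x, y')" if conf: "conf e f"
  proof -
    obtain C where C: "config C" "enabled C e" "enabled C f"
      using indep_enabled[OF assms] by blast
    define x y z where "x = code C" and "y = code (insert e C)" and "z = code (insert f C)"
    have n: "e \<notin> C" "f \<notin> C" and cf: "config (insert e C)" "config (insert f C)"
      using C by (auto simp: enabled_def)
    have S: "S x = C" "S y = insert e C" "S z = insert f C"
      using S_code C(1) cf by (simp_all add: x_def y_def z_def)
    have xy: "(x, y) \<in> cls e" and xz: "(x, z) \<in> cls f"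
      using cls_enabled C by (auto simp: x_def y_def z_def)
    have V: "x \<in> V" "y \<in> V" "z \<in> V" using cls_V xy xz by auto
    have yz: "y \<noteq> z" using S n ne by auto
    \<comment> \<open>Going from \<open>insert e C\<close> to \<open>insert f C\<close> in two steps
      that avoid \<open>C\<close> means adding \<open>f\<close> before removing \<open>e\<close>, so
      the middle vertex contains both.\<close>
    have no_square: False if w: "Adj y w" "Adj w z" "w \<noteq> x" for w
    proof -
      obtain g h where g: "(y, w) \<in> cls g" and h: "(w, z) \<in> cls h" using w Adj_cls by blast
      have wV: "w \<in> V" using cls_V g by blast
      have "S w \<noteq> S x" using w wV V S_inject by blast
      moreover have "S w = S x" if "g = e"
        using n by (simp add: that S cls_mem[OF g] set_eq_iff)
      ultimately have "g \<noteq> e" by blast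
      then have "e \<in> S w" using cls_mem[OF g, of e] S by auto
      then have "h = e" using cls_mem[OF h, of e] S n ne by (auto split: if_splits)
      then have "f \<in> S w" using cls_mem[OF h, of f] S ne by auto
      then show False using configD(4)[OF config_S[OF wV]] \<open>e \<in> S w\<close> conf by blast
    qed
    have "\<not> in_common_c4 Adj (x, y) (x, z)"
    proof
      assume "in_common_c4 Adj (x, y) (x, z)"
      then obtain a b c d where cyc: "distinct [a, b, c, d]" "Adj a b" "Adj b c" "Adj c d" "Adj d a"
        and sides: "{x, y} \<in> {{a, b}, {b, c}, {c, d}, {d, a}}" "{x, z} \<in> {{a, b}, {b, c}, {c, d}, {d, a}}"
        by (auto simp: in_common_c4_def cycle4_def)
      have sym: "Adj u v \<Longrightarrow> Adj v u" for u v using simple_graph by (auto simp: simple_graph_def)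
      have "x = a \<and> {y, z} = {b, d} \<or> x = b \<and> {y, z} = {a, c} \<or> x = c \<and> {y, z} = {b, d} \<or>
          x = d \<and> {y, z} = {a, c}"
        using sides cyc(1) yz by (auto simp: doubleton_eq_iff)
      then have "\<exists>w. Adj y w \<and> Adj w z \<and> w \<noteq> x"
        using cyc sym by (auto simp: doubleton_eq_iff)
      then show False using no_square by blast
    qed
    moreover have "gdist V Adj x origin < gdist V Adj y origin" "gdist V Adj x origin < gdist V Adj z origin"
      using V S n configD(1)[OF C(1)] by (simp_all add: gdist_origin)
    ultimately show ?thesis using xy xz by blast
  qed
  ultimately show ?thesis
    using crosses_iff[OF assms(1,2)] assms(3) unfolding contact_adj_def indep_def by blast
qed

section \<open>Out-degrees and the degree of the event structure\<close>

lemma out_nbrs_eq: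
  assumes "x \<in> V"
  shows "out_nbrs V Adj origin x = (\<lambda>e. code (insert e (S x))) ` {e. enabled (S x) e}"
proof (intro equalityI subsetI)
  fix y assume "y \<in> out_nbrs V Adj origin x"
  then have y: "Adj x y" "gdist V Adj x origin < gdist V Adj y origin" by (auto simp: out_nbrs_def)
  then obtain e where e: "(x, y) \<in> cls e" using Adj_cls by blast
  then have yV: "y \<in> V" using cls_V by blast
  have "e \<notin> S x" using cls_oriented[OF e] y yV assms by (simp add: gdist_origin)
  moreover from this have "S y = insert e (S x)" by (auto simp: cls_mem[OF e] split: if_splits)
  ultimately show "y \<in> (\<lambda>e. code (insert e (S x))) ` {e. enabled (S x) e}"
    using code_S[OF yV] config_S[OF yV] by (auto simp: enabled_def image_iff)
next
  fix y assume "y \<in> (\<lambda>e. code (insert e (S x))) ` {e. enabled (S x) e}"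
  then obtain e where e: "enabled (S x) e" "y = code (insert e (S x))" by blast
  then have xy: "(x, y) \<in> cls e" using cls_enabled[OF config_S e(1)] code_S assms by simp
  moreover have "y \<in> V" using cls_V xy by blast
  moreover have "card (S x) < card (S y)" using e cls_oriented[OF xy] by (simp add: enabled_def)
  ultimately show "y \<in> out_nbrs V Adj origin x"
    using assms Adj_cls by (auto simp: out_nbrs_def gdist_origin)
qed

lemma card_out_nbrs:
  assumes "x \<in> V"
  shows "card (out_nbrs V Adj origin x) = card {e. enabled (S x) e}"
proof -
  have "inj_on (\<lambda>e. code (insert e (S x))) {e. enabled (S x) e}"
  proof (rule inj_onI)
    fix e f assume *: "e \<in> {e. enabled (S x) e}" "f \<in> {e. enabled (S x) e}"
      "code (insert e (S x)) = code (insert f (S x))"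
    then have "insert e (S x) = insert f (S x)" using S_code by (metis enabled_def mem_Collect_eq)
    then show "e = f" using * by (auto simp: enabled_def)
  qed
  then show ?thesis using out_nbrs_eq[OF assms] card_image by auto
qed

context
  fixes k
  assumes cliques: "\<And>A. \<lbrakk>A \<subseteq> E; pairwise indep A\<rbrakk> \<Longrightarrow> finite A \<and> card A \<le> k"
begin

text \<open>Out-neighbours correspond to enabled events, which are pairwise independent; so the
  bound on independent sets also bounds out-degrees, and one configuration enabling \<open>k\<close>
  events attains both maxima.\<close>

lemma max_outdeg_eqI:
  assumes "config C" "k \<le> card {e. enabled C e}"
  shows "max_outdeg_eq V Adj origin k"
proof -
  have "finite {e. enabled (S x) e} \<and> card {e. enabled (S x) e} \<le> k" if "x \<in> V" for x
    using cliques enabled_subset enabled_pairwise_indep config_S[OF that] by blast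
  then have le_k: "finite (out_nbrs V Adj origin x) \<and> card (out_nbrs V Adj origin x) \<le> k" if "x \<in> V" for x
    using card_out_nbrs[OF that] out_nbrs_eq[OF that] that by simp
  moreover have "k \<le> card (out_nbrs V Adj origin (code C))"
    using card_out_nbrs[OF code_in[OF assms(1)]] assms by (simp add: S_code)
  ultimately show ?thesis
    unfolding max_outdeg_eq_def using code_in[OF assms(1)] by (meson order.antisym)
qed

lemma ev_degree_eqI:
  assumes "config C" "k \<le> card {e. enabled C e}"
  shows "ev_degree_eq V Adj origin k"
  unfolding ev_degree_eq_def
proof (intro conjI allI impI)
  fix T assume T: "T \<subseteq> theta_classes V Adj"
    "\<forall>e\<in>T. \<forall>f\<in>T. e \<noteq> f \<longrightarrow> ev_independent V Adj origin e f"
  obtain A where A: "A \<subseteq> E" "T = cls ` A"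
    using T(1) unfolding theta_classes_eq by (meson subset_imageE)
  have "pairwise indep A"
  proof (rule pairwiseI)
    fix e f assume "e \<in> A" "f \<in> A" "e \<noteq> f"
    moreover from this have "e \<in> E" "f \<in> E" using A by auto
    moreover from calculation have "cls e \<noteq> cls f" using cls_inj by (auto simp: inj_on_def)
    ultimately show "indep e f" using T(2) A ev_independent_iff[of e f] by blast
  qed
  then have "finite A" "card A \<le> k" using cliques A by auto
  then show "finite T" "card T \<le> k" using A(2) card_image_le[of A cls] by auto
next
  let ?A = "{e. enabled C e}"
  have A: "pairwise indep ?A" "?A \<subseteq> E" using enabled_pairwise_indep[OF assms(1)] enabled_subset by auto
  have "card (cls ` ?A) = card ?A" using A(2) cls_inj by (meson card_image inj_on_subset)
  moreover have "card ?A = k" using cliques[OF A(2,1)] assms by simp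
  moreover have "\<forall>e\<in>cls ` ?A. \<forall>f\<in>cls ` ?A. e \<noteq> f \<longrightarrow> ev_independent V Adj origin e f"
  proof (intro ballI impI)
    fix c d assume "c \<in> cls ` ?A" "d \<in> cls ` ?A" "c \<noteq> d"
    then obtain e f where "e \<in> ?A" "f \<in> ?A" "c = cls e" "d = cls f" "e \<noteq> f" by blast
    moreover from this have "indep e f" using A(1) by (auto simp: pairwise_def)
    ultimately show "ev_independent V Adj origin c d" using ev_independent_iff A(2) by blast
  qed
  ultimately show "\<exists>S\<subseteq>theta_classes V Adj.
      (\<forall>e\<in>S. \<forall>f\<in>S. e \<noteq> f \<longrightarrow> ev_independent V Adj origin e f) \<and> card S = k"
    using A(2) unfolding theta_classes_eq by (intro exI[of _ "cls ` ?A"]) blast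
qed

end

lemma infinite_V:
  assumes "infinite E"
  shows "infinite V"
proof
  assume "finite V"
  moreover have "cls ` E \<subseteq> Pow (V \<times> V)" using cls_V by auto
  ultimately have "finite (cls ` E)" by (meson finite_Pow_iff finite_SigmaI finite_subset)
  then show False using assms cls_inj finite_imageD by blast
qed

end

subsection \<open>Burling graphs\<close>

text \<open>Stage k has chromatic number above k. Its leaves are the words of length n = 2^k - 1, and the
  vertices whose subtree contains a given leaf are pairwise non-adjacent. Stage k + 1 adds, below every
  leaf u, a copy of stage k with intervals shifted by n + 1, hence away from those of stage k, and for
  every leaf t of that copy a vertex, the apex, adjacent to exactly the copied vertices active at t.
  At the leaf u @ t @ [False] of stage k + 1 the vertices active at u and at t are active; at
  u @ t @ [True] those active at u and the apex. The stage k is recovered from length u, and subtrees are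
  unbounded: below the leaves of its stage a vertex stays active for ever.\<close>

datatype burling = Base | Copy "bool list" burling | Apex "bool list" "bool list"

instance burling :: countable
  by countable_datatype

primrec root :: "burling \<Rightarrow> bool list" where
  "root Base = []"
| "root (Copy u v) = u @ root v"
| "root (Apex u t) = u @ t"

text \<open>For \<open>Copy\<close>, \<open>length u\<close> serves as the height of the copied
  stage: down to that depth the copied subtree is followed, and past a copied leaf it continues only
  through \<open>False\<close>. An apex contains \<open>u @ t\<close> itself, where it meets the
  copies active at \<open>t\<close>, and then continues only through \<open>True\<close>, where
  those copies stop.\<close>

primrec subtree :: "burling \<Rightarrow> bool list set" where
  "subtree Base = UNIV"
| "subtree (Copy u v) = {u @ x | x. x \<in> subtree v \<and> length x \<le> length u} \<union>
     {u @ t @ False # y | t y. t \<in> subtree v \<and> length t = length u}"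
| "subtree (Apex u t) = insert (u @ t) {u @ t @ True # y | y. True}"

primrec lo :: "burling \<Rightarrow> nat" where
  "lo Base = 0"
| "lo (Copy u v) = Suc (length u) + lo v"
| "lo (Apex u t) = Suc (length u)"

text \<open>With \<open>Suc (length u) = 2 ^ k\<close> the shifted intervals lie between
  \<open>2 ^ k\<close> and \<open>2 ^ Suc k\<close>. An apex fills this whole range, so its
  adjacency to copies is decided by the subtrees alone.\<close>

primrec hi :: "burling \<Rightarrow> nat" where
  "hi Base = 1"
| "hi (Copy u v) = Suc (length u) + hi v"
| "hi (Apex u t) = 2 * Suc (length u)"

primrec stage :: "nat \<Rightarrow> burling set" where
  "stage 0 = {Base}"
| "stage (Suc k) = stage k \<union> {Copy u v | u v. Suc (length u) = 2 ^ k \<and> v \<in> stage k} \<union>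
     {Apex u t | u t. Suc (length u) = 2 ^ k \<and> Suc (length t) = 2 ^ k}"

section \<open>Subtrees, leaves and the vertices active at a leaf\<close>

lemma stage_mono: "k \<le> l \<Longrightarrow> stage k \<subseteq> stage l"
  by (rule lift_Suc_mono_le) auto

definition adjacent :: "burling \<Rightarrow> burling \<Rightarrow> bool" where
  "adjacent v w \<longleftrightarrow> v \<noteq> w \<and> subtree v \<inter> subtree w \<noteq> {} \<and> lo v < hi w \<and> lo w < hi v"

lemma stage_Suc_cases [consumes 1, case_names Old Copy Apex]:
  assumes "v \<in> stage (Suc k)"
  obtains "v \<in> stage k"
  | u v' where "v = Copy u v'" "Suc (length u) = 2 ^ k" "v' \<in> stage k"
  | u t where "v = Apex u t" "Suc (length u) = 2 ^ k" "Suc (length t) = 2 ^ k"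
  using assms by auto

text \<open>No root is deeper than the leaves of its stage, so a point of a subtree can be truncated
  to leaf depth without leaving the subtree.\<close>

lemma root_in_subtree: "v \<in> stage k \<Longrightarrow> root v \<in> subtree v \<and> length (root v) < 2 ^ k"
proof (induction k arbitrary: v)
  case (Suc k)
  from Suc.prems show ?case
  proof (cases rule: stage_Suc_cases)
    case Old
    then show ?thesis using Suc.IH[of v] by auto
  next
    case (Copy u v')
    then show ?thesis using Suc.IH[of v'] by auto
  next
    case (Apex u t)
    then show ?thesis by auto
  qed
qed auto

lemma prefix_root: "x \<in> subtree v \<Longrightarrow> prefix (root v) x"
  by (induction v arbitrary: x) (auto simp: prefix_append)

text \<open>Connectedness of the subtree. For a copy, a prefix reaching below a copied leaf has to
  start there with \<open>False\<close>, as the given word does.\<close>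

lemma subtree_interval:
  "\<lbrakk>x \<in> subtree v; prefix (root v) y; prefix y x\<rbrakk> \<Longrightarrow> y \<in> subtree v"
proof (induction v arbitrary: x y)
  case Base
  then show ?case by simp
next
  case (Copy u v)
  from Copy.prems(2) obtain z where y: "y = u @ z" and z: "prefix (root v) z"
    by (auto simp: prefix_def)
  from Copy.prems(1) consider
    x' where "x = u @ x'" "x' \<in> subtree v" "length x' \<le> length u"
    | t w where "x = u @ t @ False # w" "t \<in> subtree v" "length t = length u"
    by auto
  then show ?case
  proof cases
    case 1
    then have "prefix z x'" using Copy.prems(3) y by simp
    then have "z \<in> subtree v" "length z \<le> length u"
      using Copy.IH[OF 1(2) z] 1 prefix_length_le[of z x'] by auto
    then show ?thesis using y by auto
  next
    case 2
    then have "prefix z (t @ False # w)" using Copy.prems(3) y by simp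
    then consider "prefix z t" | s where "z = t @ s" "s \<noteq> []" "prefix s (False # w)"
      unfolding prefix_append by (metis append_Nil2 prefix_order.refl)
    then show ?thesis
    proof cases
      case 1
      then have "z \<in> subtree v" "length z \<le> length u"
        using Copy.IH[OF 2(2) z] 2 prefix_length_le[of z t] by auto
      then show ?thesis using y by auto
    next
      case s: 2
      then obtain s' where "s = False # s'" by (auto simp: prefix_Cons)
      then show ?thesis using y s 2 by auto
    qed
  qed
next
  case (Apex u t)
  then show ?case by (auto simp: prefix_def append_eq_append_conv2 append_eq_Cons_conv)
qed

lemma lo_less_hi: "lo v < hi v"
  by (induction v) auto

lemma hi_le: "v \<in> stage k \<Longrightarrow> hi v \<le> 2 ^ k"
proof (induction k arbitrary: v)
  case (Suc k)
  from Suc.prems show ?case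
    by (cases rule: stage_Suc_cases) (use Suc.IH in \<open>fastforce+\<close>)
qed auto

lemma subtree_extend:
  "\<lbrakk>v \<in> stage k; t \<in> subtree v; Suc (length t) = 2 ^ k\<rbrakk> \<Longrightarrow> t @ y \<in> subtree v"
proof (induction k arbitrary: v t y)
  case (Suc k)
  have len: "length t = 2 * (2 ^ k - 1) + 1" using Suc.prems(3) by simp
  from Suc.prems(1) show ?case
  proof (cases rule: stage_Suc_cases)
    case Old
    \<comment> \<open>The leaf of stage \<open>k\<close> above \<open>t\<close>; convexity puts it
      in the subtree, and the induction hypothesis extends it by any word.\<close>
    define p where "p = take (2 ^ k - 1) t"
    have p: "Suc (length p) = 2 ^ k" "t = p @ drop (2 ^ k - 1) t"
      unfolding p_def using len by auto
    have "prefix (root v) t" "prefix p t"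
      using prefix_root[OF Suc.prems(2)] by (auto simp: p_def take_is_prefix)
    moreover have "length (root v) \<le> length p" using root_in_subtree[OF Old] p by simp
    ultimately have "prefix (root v) p" by (rule prefix_length_prefix)
    then have "p \<in> subtree v" using subtree_interval Suc.prems(2) \<open>prefix p t\<close> by blast
    then have "p @ drop (2 ^ k - 1) t @ y \<in> subtree v" using Suc.IH[OF Old] p(1) by blast
    then show ?thesis using p(2) by (metis append.assoc)
  next
    case (Copy u v')
    \<comment> \<open>The other part of the subtree has words of length at most
      \<open>2 * length u\<close>, one less than the length of \<open>t\<close>.\<close>
    then obtain s z where "t = u @ s @ False # z" "s \<in> subtree v'" "length s = length u"
      using Suc.prems(2) len by auto
    then show ?thesis unfolding Copy(1) by auto
  next
    case (Apex u s)
    then show ?thesis using Suc.prems(2) len by auto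
  qed
qed auto

lemma drop_all_but_last: "length x = Suc n \<Longrightarrow> drop n x = [last x]"
  by (induction x arbitrary: n) (auto simp: drop_Cons length_Suc_conv split: nat.splits)

text \<open>Leaf depths satisfy \<open>2 ^ Suc k - 1 = 2 * (2 ^ k - 1) + 1\<close>: an old leaf, a
  leaf of the copy below it, and one letter choosing between copies and apex.\<close>

lemma leaf_cases:
  assumes "Suc (length x) = 2 ^ Suc k"
  obtains u t b where "x = u @ t @ [b]" "Suc (length u) = 2 ^ k" "Suc (length t) = 2 ^ k"
proof
  define n :: nat where "n = 2 ^ k - 1"
  have n: "Suc n = 2 ^ k" by (simp add: n_def)
  then have len: "length x = Suc (2 * n)" using assms by simp
  then show "Suc (length (take n x)) = 2 ^ k" "Suc (length (take n (drop n x))) = 2 ^ k"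
    using n by auto
  have "drop n x = take n (drop n x) @ drop n (drop n x)"
    by (simp only: append_take_drop_id)
  moreover have "drop n (drop n x) = [last x]"
    using len by (simp add: mult_2 drop_all_but_last)
  ultimately have "drop n x = take n (drop n x) @ [last x]" by simp
  then show "x = take n x @ take n (drop n x) @ [last x]" by (metis append_take_drop_id)
qed

context
  fixes k :: nat and u t :: "bool list" and b :: bool
  assumes u: "Suc (length u) = 2 ^ k" and t: "Suc (length t) = 2 ^ k"
begin

text \<open>The root of \<open>v\<close> is at most as long as \<open>u\<close>, hence a prefix of
  it, and convexity applies; the converse is \<open>subtree_extend\<close>.\<close>

lemma leaf_old:
  assumes "v \<in> stage k"
  shows "u @ t @ [b] \<in> subtree v \<longleftrightarrow> u \<in> subtree v"
proof
  assume *: "u @ t @ [b] \<in> subtree v"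
  have "prefix (root v) u"
    by (rule prefix_length_prefix[OF prefix_root[OF *]]) (use root_in_subtree[OF assms] u in simp_all)
  then show "u \<in> subtree v" by (rule subtree_interval[OF *]) simp
next
  assume "u \<in> subtree v"
  then show "u @ t @ [b] \<in> subtree v" using subtree_extend[OF assms _ u] by blast
qed

lemma leaf_Copy:
  assumes "Suc (length u') = 2 ^ k"
  shows "u @ t @ [b] \<in> subtree (Copy u' v) \<longleftrightarrow> u' = u \<and> \<not> b \<and> t \<in> subtree v"
proof
  assume "u @ t @ [b] \<in> subtree (Copy u' v)"
  then show "u' = u \<and> \<not> b \<and> t \<in> subtree v" using u t assms by auto
next
  assume *: "u' = u \<and> \<not> b \<and> t \<in> subtree v"
  moreover have "length t = length u" using u t by simp
  ultimately have "\<exists>s y. u @ t @ [b] = u @ s @ False # y \<and> s \<in> subtree v \<and> length s = length u"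
    by (intro exI[of _ t] exI[of _ "[]"]) simp
  with * show "u @ t @ [b] \<in> subtree (Copy u' v)" by simp
qed

lemma leaf_Apex:
  assumes "Suc (length u') = 2 ^ k" "Suc (length t') = 2 ^ k"
  shows "u @ t @ [b] \<in> subtree (Apex u' t') \<longleftrightarrow> u' = u \<and> t' = t \<and> b"
  using u t assms by auto

end

section \<open>Adjacency in a stage: triangles and colours\<close>

lemma adjacent_commute: "adjacent v w \<longleftrightarrow> adjacent w v"
  by (auto simp: adjacent_def)

lemma adjacent_old_new:
  assumes "v \<in> stage k" "2 ^ k \<le> lo w"
  shows "\<not> adjacent v w" "\<not> adjacent w v"
  using hi_le[OF assms(1)] assms(2) by (auto simp: adjacent_def)

lemma adjacent_CopyD:
  assumes "length u = length u'" "adjacent (Copy u v) (Copy u' v')"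
  shows "u = u' \<and> adjacent v v'"
proof -
  obtain z where "z \<in> subtree (Copy u v)" "z \<in> subtree (Copy u' v')"
    using assms(2) by (auto simp: adjacent_def simp del: subtree.simps)
  then have "u = u' \<and> (\<exists>x. x \<in> subtree v \<and> x \<in> subtree v')"
    using assms(1) by auto
  then show ?thesis using assms(2) by (auto simp: adjacent_def simp del: subtree.simps)
qed

lemma adjacent_CopyI:
  assumes "v \<in> stage k" "w \<in> stage k" "Suc (length u) = 2 ^ k" "adjacent v w"
  shows "adjacent (Copy u v) (Copy u w)"
proof -
  obtain x where x: "x \<in> subtree v" "x \<in> subtree w" using assms(4) by (auto simp: adjacent_def)
  \<comment> \<open>The common point may lie deeper than the part of the tree that is copied, so it
    is truncated to the height of that part.\<close>
  let ?y = "take (length u) x"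
  have y: "?y \<in> subtree v'" if "v' \<in> stage k" "x \<in> subtree v'" for v'
  proof (rule subtree_interval[OF that(2) _ take_is_prefix])
    show "prefix (root v') ?y"
      using root_in_subtree[OF that(1)] prefix_root[OF that(2)] assms(3)
      by (auto simp: prefix_def)
  qed
  have "u @ ?y \<in> subtree (Copy u v)" "u @ ?y \<in> subtree (Copy u w)"
    using y assms(1,2) x by auto
  then show ?thesis using assms(4) by (auto simp: adjacent_def simp del: subtree.simps)
qed

lemma adjacent_Copy_ApexD:
  assumes "length u = length u'" "length t = length u'" "adjacent (Copy u v) (Apex u' t)"
  shows "u = u' \<and> t \<in> subtree v"
proof -
  obtain z where "z \<in> subtree (Copy u v)" "z \<in> subtree (Apex u' t)"
    using assms(3) by (auto simp: adjacent_def simp del: subtree.simps)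
  then show ?thesis using assms(1,2) by auto
qed

lemma not_adjacent_Apex_Apex:
  assumes "length u = length u'" "length t = length t'"
  shows "\<not> adjacent (Apex u t) (Apex u' t')"
proof
  assume adj: "adjacent (Apex u t) (Apex u' t')"
  then obtain z where "z \<in> subtree (Apex u t)" "z \<in> subtree (Apex u' t')"
    by (auto simp: adjacent_def simp del: subtree.simps)
  then have "u = u' \<and> t = t'" using assms by auto
  then show False using adj by (simp add: adjacent_def)
qed

text \<open>Old and new vertices have disjoint intervals. Old ones active at \<open>u\<close> and
  copies active at \<open>t\<close> are independent by induction, and the only apex active at the
  leaf never occurs together with copies.\<close>

lemma stage_leaf_independent:
  "\<lbrakk>Suc (length x) = 2 ^ k; v \<in> stage k; w \<in> stage k; x \<in> subtree v; x \<in> subtree w\<rbrakk> \<Longrightarrow> \<not> adjacent v w"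
proof (induction k arbitrary: x v w)
  case 0
  then show ?case by (simp add: adjacent_def)
next
  case (Suc k)
  obtain u t b where x: "x = u @ t @ [b]" and len: "Suc (length u) = 2 ^ k" "Suc (length t) = 2 ^ k"
    using leaf_cases[OF Suc.prems(1)] by blast
  note leaf = leaf_old[OF len] leaf_Copy[OF len] leaf_Apex[OF len]
  from Suc.prems(2) show ?case
  proof (cases rule: stage_Suc_cases)
    case v: Old
    from Suc.prems(3) show ?thesis
    proof (cases rule: stage_Suc_cases)
      case w: Old
      then show ?thesis using Suc.IH[OF len(1) v w] Suc.prems leaf v x by simp
    qed (use adjacent_old_new[OF v] in auto)
  next
    case v: (Copy u1 v1)
    from Suc.prems(3) show ?thesis
    proof (cases rule: stage_Suc_cases)
      case w: Old
      then show ?thesis using adjacent_old_new[OF w] v by auto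
    next
      case w: (Copy u2 v2)
      then have "u1 = u" "u2 = u" "t \<in> subtree v1" "t \<in> subtree v2"
        using Suc.prems leaf v x by auto
      then show ?thesis using Suc.IH[OF len(2) v(3) w(3)] v w adjacent_CopyD[of u1 u2 v1 v2] by auto
    next
      case w: (Apex u2 t2)
      then show ?thesis using Suc.prems leaf v x by simp
    qed
  next
    case v: (Apex u1 t1)
    from Suc.prems(3) show ?thesis
    proof (cases rule: stage_Suc_cases)
      case w: Old
      then show ?thesis using adjacent_old_new[OF w] v by auto
    next
      case w: (Copy u2 v2)
      then show ?thesis using Suc.prems leaf v x by simp
    next
      case w: (Apex u2 t2)
      then show ?thesis using Suc.prems leaf v x by (simp add: adjacent_def)
    qed
  qed
qed

text \<open>A triangle is entirely old or entirely new. Three copies project to a triangle of stage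
  \<open>k\<close>, two apexes are never adjacent, and two copies adjacent to one apex come from
  vertices active at the same leaf, which are not adjacent.\<close>

lemma stage_triangle_free:
  "\<lbrakk>a \<in> stage k; b \<in> stage k; c \<in> stage k; adjacent a b; adjacent b c\<rbrakk> \<Longrightarrow> \<not> adjacent a c"
proof (induction k arbitrary: a b c)
  case 0
  then show ?case by (simp add: adjacent_def)
next
  case (Suc k)
  define new where "new v \<longleftrightarrow> (\<exists>u v'. v = Copy u v' \<and> Suc (length u) = 2 ^ k \<and> v' \<in> stage k) \<or>
    (\<exists>u t. v = Apex u t \<and> Suc (length u) = 2 ^ k \<and> Suc (length t) = 2 ^ k)" for v
  have old_or_new: "v \<in> stage k \<or> new v" if "v \<in> stage (Suc k)" for v
    using that unfolding new_def by (cases rule: stage_Suc_cases) auto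
  have new_lo: "2 ^ k \<le> lo v" if "new v" for v
    using that by (auto simp: new_def)
  have CCA: False
    if "new (Copy u1 v1)" "new (Copy u2 v2)" "new (Apex u3 t3)" "adjacent (Copy u1 v1) (Copy u2 v2)"
      "adjacent (Copy u1 v1) (Apex u3 t3)" "adjacent (Copy u2 v2) (Apex u3 t3)" for u1 v1 u2 v2 u3 t3
  proof -
    have len: "length u1 = length u2" "length u1 = length u3" "length u2 = length u3" "length t3 = length u3"
      "Suc (length t3) = 2 ^ k" and st: "v1 \<in> stage k" "v2 \<in> stage k"
      using that(1-3) unfolding new_def by auto
    have "adjacent v1 v2" "t3 \<in> subtree v1" "t3 \<in> subtree v2"
      using that(4-6) adjacent_CopyD[OF len(1)] adjacent_Copy_ApexD[OF len(2,4)]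
        adjacent_Copy_ApexD[OF len(3,4)] by blast+
    then show False using stage_leaf_independent[OF len(5) st] by blast
  qed
  show ?case
  proof
    assume ac: "adjacent a c"
    show False
    proof (cases "a \<in> stage k")
      case True
      have step: "w \<in> stage k" if "adjacent a w" "w \<in> stage (Suc k)" for w
        using adjacent_old_new(1)[OF True new_lo] old_or_new[OF that(2)] that(1) by blast
      have "b \<in> stage k" "c \<in> stage k"
        using step[OF Suc.prems(4,2)] step[OF ac Suc.prems(3)] by blast+
      then show False using Suc.IH True Suc.prems ac by blast
    next
      case False
      then have a: "new a" using Suc.prems old_or_new by blast
      have step: "new w" if "adjacent v w" "new v" "w \<in> stage (Suc k)" for v w
        using adjacent_old_new(2)[OF _ new_lo[OF that(2)]] old_or_new[OF that(3)] that(1) by blast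
      have b: "new b" and c: "new c"
        using step[OF Suc.prems(4) a Suc.prems(2)] step[OF ac a Suc.prems(3)] by blast+
      have AA: False if "new (Apex u t)" "new (Apex u' t')" "adjacent (Apex u t) (Apex u' t')" for u t u' t'
        using that not_adjacent_Apex_Apex[of u u' t t'] by (auto simp: new_def)
      have CCC: False if "a = Copy u1 v1" "b = Copy u2 v2" "c = Copy u3 v3" for u1 v1 u2 v2 u3 v3
      proof -
        have len: "length u1 = length u2" "length u2 = length u3" "length u1 = length u3"
          and st: "v1 \<in> stage k" "v2 \<in> stage k" "v3 \<in> stage k"
          using a b c that unfolding new_def by auto
        then show False
          using Suc.IH[OF st] Suc.prems(4,5) ac adjacent_CopyD[OF len(1)] adjacent_CopyD[OF len(2)]
            adjacent_CopyD[OF len(3)] unfolding that by blast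
      qed
      have form: "(\<exists>u v'. v = Copy u v') \<or> (\<exists>u t. v = Apex u t)" if "new v" for v
        using that by (auto simp: new_def)
      have ab: "adjacent a b" and bc: "adjacent b c" using Suc.prems(4,5) .
      have ca: "adjacent c a" and ba: "adjacent b a" and cb: "adjacent c b"
        using ac ab bc adjacent_commute by blast+
      show False
        using form[OF a] form[OF b] form[OF c]
      proof (elim disjE exE)
        fix u v u' v' u'' v'' assume "a = Copy u v" "b = Copy u' v'" "c = Copy u'' v''"
        then show False by (rule CCC)
      next
        fix u v u' v' u'' t'' assume "a = Copy u v" "b = Copy u' v'" "c = Apex u'' t''"
        then show False using CCA a b c ab ac bc by metis
      next
        fix u v u' t' u'' v'' assume "a = Copy u v" "b = Apex u' t'" "c = Copy u'' v''"
        then show False using CCA a b c ab ac cb by metis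
      next
        fix u t u' v' u'' v'' assume "a = Apex u t" "b = Copy u' v'" "c = Copy u'' v''"
        then show False using CCA a b c bc ba ca by metis
      qed (use AA a b c ab bc ac in metis)+
    qed
  qed
qed

text \<open>The induction needs many colours at a single leaf. Let \<open>A\<close> and
  \<open>B\<close> be the colour sets at \<open>u\<close> and, in the copy below it, at
  \<open>t\<close>. If they differ, their union is larger and shows at the \<open>False\<close>
  leaf; if they agree, the apex avoids \<open>B\<close> and adds a colour to \<open>A\<close> at the
  \<open>True\<close> leaf.\<close>

lemma stage_many_colors:
  "\<lbrakk>finite (col ` stage k); \<And>v w. \<lbrakk>v \<in> stage k; w \<in> stage k; adjacent v w\<rbrakk> \<Longrightarrow> col v \<noteq> col w\<rbrakk> \<Longrightarrow>
     \<exists>x. Suc (length x) = 2 ^ k \<and> k < card (col ` {v \<in> stage k. x \<in> subtree v})"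
proof (induction k arbitrary: col)
  case 0
  have "{v \<in> stage 0. [] \<in> subtree v} = {Base}" by auto
  then show ?case by (intro exI[of _ "[]"]) simp
next
  case (Suc k)
  define act where "act x = {v \<in> stage k. x \<in> subtree v}" for x
  have "finite (col ` stage k)" using Suc.prems(1) by (rule rev_finite_subset) auto
  then obtain u where u: "Suc (length u) = 2 ^ k" "k < card (col ` act u)"
    using Suc.IH[of col] Suc.prems(2) unfolding act_def by auto
  have copy: "Copy u v \<in> stage (Suc k)" if "v \<in> stage k" for v
    using that u by auto
  have "finite ((\<lambda>v. col (Copy u v)) ` stage k)"
    using Suc.prems(1) by (rule rev_finite_subset) (use copy in auto)
  moreover have "col (Copy u v) \<noteq> col (Copy u w)"
    if "v \<in> stage k" "w \<in> stage k" "adjacent v w" for v w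
    using Suc.prems(2)[OF copy[OF that(1)] copy[OF that(2)]] adjacent_CopyI[OF that(1,2) u(1) that(3)] .
  \<comment> \<open>The hypothesis is applied to the colouring induced on the copy below this
    \<open>u\<close>, so \<open>t\<close> depends on \<open>u\<close> and the colouring. This is why
    every leaf receives a copy and every leaf of the copy an apex.\<close>
  ultimately obtain t where t: "Suc (length t) = 2 ^ k" "k < card ((\<lambda>v. col (Copy u v)) ` act t)"
    using Suc.IH[of "\<lambda>v. col (Copy u v)"] unfolding act_def by auto
  define A B where "A = col ` act u" and "B = (\<lambda>v. col (Copy u v)) ` act t"
  have apex: "Apex u t \<in> stage (Suc k)" using u t by auto
  have fin: "finite (col ` {v \<in> stage (Suc k). x \<in> subtree v})" for x
    using Suc.prems(1) by (rule rev_finite_subset) auto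
  note leaf = leaf_old[OF u(1) t(1)] leaf_Copy[OF u(1) t(1) u(1)] leaf_Apex[OF u(1) t(1) u(1) t(1)]
  have A: "A \<subseteq> col ` {v \<in> stage (Suc k). u @ t @ [b] \<in> subtree v}" for b
    using leaf by (auto simp: A_def act_def)
  have B: "B \<subseteq> col ` {v \<in> stage (Suc k). u @ t @ [False] \<in> subtree v}"
    using leaf copy by (auto simp del: subtree.simps stage.simps simp: B_def act_def)
  have Ap: "col (Apex u t) \<in> col ` {v \<in> stage (Suc k). u @ t @ [True] \<in> subtree v}"
    using leaf apex by blast
  have len: "Suc (length (u @ t @ [b])) = 2 ^ Suc k" for b using u t by simp
  have notB: "col (Apex u t) \<notin> B"
  proof
    assume "col (Apex u t) \<in> B"
    then obtain v where v: "v \<in> stage k" "t \<in> subtree v" "col (Copy u v) = col (Apex u t)"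
      by (auto simp: B_def act_def)
    have "u @ t \<in> subtree (Copy u v)" using v u t by auto
    moreover have "lo v < 2 ^ k" using lo_less_hi[of v] hi_le[OF v(1)] by simp
    ultimately have "adjacent (Copy u v) (Apex u t)"
      using u lo_less_hi[of v] by (auto simp: adjacent_def)
    then show False using Suc.prems(2) v copy apex by blast
  qed
  have cards: "Suc k \<le> card A" "Suc k \<le> card B" using u t by (auto simp: A_def B_def)
  show ?case
  proof (cases "A = B")
    case True
    have "Suc k < card (insert (col (Apex u t)) A)"
      using cards notB True by (metis card.infinite card_insert_disjoint le_imp_less_Suc not_less_eq_eq zero_le)
    also have "\<dots> \<le> card (col ` {v \<in> stage (Suc k). u @ t @ [True] \<in> subtree v})"
      using fin A Ap by (intro card_mono) auto
    finally show ?thesis using len by blast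
  next
    case False
    have finAB: "finite A" "finite B" using cards by (auto intro: card_ge_0_finite)
    have "Suc k < card (A \<union> B)"
    proof (rule ccontr)
      assume "\<not> Suc k < card (A \<union> B)"
      then have "card (A \<union> B) \<le> card A" "card (A \<union> B) \<le> card B" using cards by auto
      then have "A = A \<union> B" "B = A \<union> B" using finAB by (intro card_seteq; simp)+
      then show False using False by simp
    qed
    also have "\<dots> \<le> card (col ` {v \<in> stage (Suc k). u @ t @ [False] \<in> subtree v})"
      using fin A B by (intro card_mono) auto
    finally show ?thesis using len by blast
  qed
qed

subsection \<open>The event structure\<close>

definition burling_vertices :: "burling set" where
  "burling_vertices = (\<Union>k. stage k)"

datatype event = Node "bool list" | Tick nat | Lift burling

instance event :: countable
  by countable_datatype

text \<open>A finite configuration contains the nodes on a path from the root to a word x of the infinite binary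
  tree (possibly none), an initial segment of ticks of length j, and at most one event Lift v, which requires that x lies in
  the subtree of v and that j lies in the interval from lo v to hi v, right end excluded.\<close>

definition events :: "event set" where
  "events = range Node \<union> range Tick \<union> Lift ` burling_vertices"

fun below :: "event \<Rightarrow> event \<Rightarrow> bool" where
  "below (Node p) (Node q) \<longleftrightarrow> prefix p q"
| "below (Node p) (Lift v) \<longleftrightarrow> prefix p (root v)"
| "below (Tick i) (Tick j) \<longleftrightarrow> i \<le> j"
| "below (Tick i) (Lift v) \<longleftrightarrow> i < lo v"
| "below (Lift v) (Lift w) \<longleftrightarrow> v = w"
| "below _ _ \<longleftrightarrow> False"

text \<open>A configuration containing \<open>Tick i\<close> has at least \<open>Suc i\<close>
  ticks, hence the comparison of \<open>hi v\<close> with \<open>Suc i\<close>. A node rules out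
  \<open>Lift v\<close> whether it branches off above the root of \<open>v\<close> or leaves the
  subtree below it.\<close>

fun clash :: "event \<Rightarrow> event \<Rightarrow> bool" where
  "clash (Node p) (Node q) \<longleftrightarrow> \<not> prefix p q \<and> \<not> prefix q p"
| "clash (Node p) (Lift v) \<longleftrightarrow> \<not> prefix p (root v) \<and> p \<notin> subtree v"
| "clash (Lift v) (Node p) \<longleftrightarrow> \<not> prefix p (root v) \<and> p \<notin> subtree v"
| "clash (Tick i) (Lift v) \<longleftrightarrow> hi v \<le> Suc i"
| "clash (Lift v) (Tick i) \<longleftrightarrow> hi v \<le> Suc i"
| "clash (Lift v) (Lift w) \<longleftrightarrow> v \<noteq> w"
| "clash _ _ \<longleftrightarrow> False"

section \<open>The order and conflict axioms\<close>

lemma below_antisym: "\<lbrakk>below e f; below f e\<rbrakk> \<Longrightarrow> e = f"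
  by (cases e; cases f) (auto dest: prefix_order.antisym)

lemma below_trans: "\<lbrakk>below e f; below f g\<rbrakk> \<Longrightarrow> below e g"
  by (cases e; cases f; cases g; simp; meson prefix_order.trans order.trans le_less_trans)

lemma finite_below: "finite {f. below f e}"
proof -
  have "finite {p. prefix p q}" for q :: "bool list"
    by (rule finite_subset[of _ "set (prefixes q)"]) auto
  then have "finite (Node ` {p. prefix p q} \<union> Tick ` {..n} \<union> {e})" for q n by simp
  moreover have "\<exists>q n. {f. below f e} \<subseteq> Node ` {p. prefix p q} \<union> Tick ` {..n} \<union> {e}"
  proof (cases e)
    case (Node q)
    have "below f e \<Longrightarrow> f \<in> Node ` {p. prefix p q} \<union> Tick ` {..0} \<union> {e}" for f
      using Node by (cases f) auto
    then show ?thesis by blast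
  next
    case (Tick n)
    have "below f e \<Longrightarrow> f \<in> Node ` {p. prefix p []} \<union> Tick ` {..n} \<union> {e}" for f
      using Tick by (cases f) auto
    then show ?thesis by blast
  next
    case (Lift v)
    have "below f e \<Longrightarrow> f \<in> Node ` {p. prefix p (root v)} \<union> Tick ` {..lo v} \<union> {e}" for f
      using Lift by (cases f) auto
    then show ?thesis by blast
  qed
  ultimately show ?thesis by (meson finite_subset)
qed

lemma clash_commute: "clash e f \<longleftrightarrow> clash f e"
  by (cases e; cases f) auto

lemma clash_Node_Lift:
  assumes "\<not> prefix p q" "\<not> prefix q p" "prefix q (root v)"
  shows "clash (Node p) (Lift v)"
proof -
  have "\<not> prefix p (root v)"
    using assms prefix_same_cases by blast
  moreover have "p \<notin> subtree v"
    using assms prefix_root prefix_order.trans by blast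
  ultimately show ?thesis by simp
qed

text \<open>By convexity, a path that has left the subtree never enters it again.\<close>

lemma clash_Lift_Node:
  assumes "clash (Lift v) (Node p)" "prefix p q"
  shows "clash (Lift v) (Node q)"
proof -
  have p: "\<not> prefix p (root v)" "p \<notin> subtree v" using assms(1) by auto
  have "\<not> prefix q (root v)" using p assms(2) prefix_order.trans by blast
  moreover have "q \<notin> subtree v"
  proof
    assume q: "q \<in> subtree v"
    then have "prefix (root v) p"
      using prefix_same_cases[OF assms(2) prefix_root[OF q]] p by blast
    then show False using subtree_interval[OF q _ assms(2)] p by blast
  qed
  ultimately show ?thesis by simp
qed

lemma clash_below:
  assumes "clash e f" "below f g"
  shows "clash e g"
proof (cases e)
  case e: (Node p)
  show ?thesis
  proof (cases f)
    case f: (Node q)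
    then show ?thesis using assms e clash_Node_Lift[of p q]
      by (cases g) (auto dest: prefix_order.trans prefix_same_cases simp del: clash.simps(2))
  qed (use assms e in \<open>cases g; simp\<close>)+
next
  case e: (Tick i)
  then show ?thesis using assms by (cases f; cases g) auto
next
  case e: (Lift v)
  show ?thesis
  proof (cases f)
    case f: (Node q)
    then show ?thesis using assms e clash_Lift_Node[of v q]
      by (cases g) auto
  next
    case f: (Tick i)
    then show ?thesis using assms e lo_less_hi[of v] by (cases g) auto
  next
    case f: (Lift w)
    then show ?thesis using assms e by (cases g) auto
  qed
qed

interpretation burling: event_structure events below clash
proof
  show "below e e" for e by (cases e) auto
  show "\<not> clash e e" for e by (cases e) auto
  show "finite {f \<in> events. below f e}" for e
    by (rule finite_subset[OF _ finite_below]) auto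
qed (use below_antisym below_trans clash_commute clash_below in blast)+

section \<open>Independent events and the constant 5\<close>

lemma Node_event [simp]: "Node p \<in> events" and Tick_event [simp]: "Tick i \<in> events"
  by (auto simp: events_def)

lemma adjacent_imp_indep:
  assumes "adjacent v w"
  shows "burling.indep (Lift v) (Lift w)"
proof -
  have *: "\<not> clash x (Lift w)" if "adjacent v w" "x \<noteq> Lift v" "below x (Lift v)" for x v w
  proof (cases x)
    case (Node p)
    obtain z where z: "z \<in> subtree v" "z \<in> subtree w" using \<open>adjacent v w\<close> by (auto simp: adjacent_def)
    \<comment> \<open>Any node required by \<open>v\<close> lies above the common point
      \<open>z\<close>, and so does \<open>root w\<close>; thus the node is either above
      \<open>root w\<close> or between it and \<open>z\<close>.\<close>
    have p: "prefix p z" using that Node prefix_root[OF z(1)] by (auto dest: prefix_order.trans)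
    then have "prefix p (root w) \<or> p \<in> subtree w"
      using prefix_same_cases[OF p prefix_root[OF z(2)]] subtree_interval[OF z(2)] by blast
    then show ?thesis using Node by simp
  next
    case (Tick i)
    then show ?thesis using that by (auto simp: adjacent_def)
  next
    case (Lift u)
    then show ?thesis using that by auto
  qed
  have "v \<noteq> w" using assms by (simp add: adjacent_def)
  then show ?thesis
    using *[OF assms] *[OF assms[unfolded adjacent_commute[of v]]] unfolding burling.indep_def by auto
qed

text \<open>It is enough to test the last predecessors of \<open>Lift v\<close>, namely
  \<open>Node (root v)\<close> and the tick before \<open>lo v\<close>, against
  \<open>Lift w\<close>, and conversely.\<close>

lemma indep_imp_adjacent:
  assumes "burling.indep (Lift v) (Lift w)" "v \<in> burling_vertices" "w \<in> burling_vertices"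
  shows "adjacent v w"
proof -
  have *: "(prefix (root v) (root w) \<or> root v \<in> subtree w) \<and> lo v < hi w"
    if "\<And>x. \<lbrakk>x \<in> events; x \<noteq> Lift v; below x (Lift v)\<rbrakk> \<Longrightarrow> \<not> clash x (Lift w)" for v w
  proof
    show "prefix (root v) (root w) \<or> root v \<in> subtree w" using that[of "Node (root v)"] by auto
    show "lo v < hi w"
    proof (cases "lo v")
      case 0
      then show ?thesis using lo_less_hi[of w] by simp
    next
      case (Suc i)
      then show ?thesis using that[of "Tick i"] by simp
    qed
  qed
  have root: "root v \<in> subtree v" "root w \<in> subtree w"
    using assms root_in_subtree by (auto simp: burling_vertices_def)
  have v: "(prefix (root v) (root w) \<or> root v \<in> subtree w) \<and> lo v < hi w"
    and w: "(prefix (root w) (root v) \<or> root w \<in> subtree v) \<and> lo w < hi v"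
    using assms(1) by (auto intro!: * simp only: burling.indep_def)
  \<comment> \<open>One of the two roots lies in both subtrees: otherwise each root is a prefix of
    the other, so the roots coincide.\<close>
  have "subtree v \<inter> subtree w \<noteq> {}"
    using v w root prefix_order.antisym[of "root v" "root w"] by auto
  moreover have "v \<noteq> w" using assms(1) by (auto simp: burling.indep_def)
  ultimately show ?thesis using v w by (simp add: adjacent_def)
qed

text \<open>Two incomparable words already conflict at the letter where they split, so a minimal
  conflict allows no further letters. The last letters are then distinct truth values, which leaves
  room for two nodes.\<close>

lemma indep_Node:
  assumes "burling.indep (Node p) (Node q)"
  shows "p \<noteq> [] \<and> q \<noteq> [] \<and> butlast p = butlast q \<and> last p \<noteq> last q"
proof -
  have "p \<parallel> q" using assms by (auto simp: burling.indep_def)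
  then obtain r b ps c qs where d: "b \<noteq> c" "p = r @ b # ps" "q = r @ c # qs"
    using parallel_decomp[of p q] by blast
  have "ps = []"
  proof (rule ccontr)
    assume "ps \<noteq> []"
    then have "Node (r @ [b]) \<noteq> Node p" "below (Node (r @ [b])) (Node p)" "clash (Node (r @ [b])) (Node q)"
      using d by simp_all
    then show False using assms unfolding burling.indep_def by (metis Node_event)
  qed
  moreover have "qs = []"
  proof (rule ccontr)
    assume "qs \<noteq> []"
    then have "Node (r @ [c]) \<noteq> Node q" "below (Node (r @ [c])) (Node q)" "clash (Node (r @ [c])) (Node p)"
      using d by simp_all
    then show False using assms unfolding burling.indep_def by (metis Node_event)
  qed
  ultimately show ?thesis using d by simp
qed

lemma clique_bound:
  assumes A: "A \<subseteq> events" "pairwise burling.indep A"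
  shows "finite A \<and> card A \<le> 5"
proof -
  have ind: "burling.indep x y" if "x \<in> A" "y \<in> A" "x \<noteq> y" for x y
    using A(2) that by (auto simp: pairwise_def)
  have nodes: "finite (A \<inter> range Node) \<and> card (A \<inter> range Node) \<le> 2"
  proof (rule finite_card_leI)
    fix T assume T: "T \<subseteq> A \<inter> range Node" "card T = Suc 2"
    then have "card T = 3" by simp
    then obtain x y z where xyz: "T = {x, y, z}" "x \<noteq> y" "y \<noteq> z" "x \<noteq> z"
      unfolding card_3_iff by blast
    then obtain p q r where "x = Node p" "y = Node q" "z = Node r" using T by auto
    then have "last p \<noteq> last q" "last q \<noteq> last r" "last p \<noteq> last r"
      using xyz T(1) ind[of x y] ind[of y z] ind[of x z] indep_Node[of p q] indep_Node[of q r]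
        indep_Node[of p r] by simp_all
    then show False by auto
  qed
  have ticks: "finite (A \<inter> range Tick) \<and> card (A \<inter> range Tick) \<le> 1"
  proof (rule finite_card_leI)
    fix T assume T: "T \<subseteq> A \<inter> range Tick" "card T = Suc 1"
    then have "card T = 2" by simp
    then obtain x y where xy: "T = {x, y}" "x \<noteq> y"
      unfolding card_2_iff by blast
    then obtain i j where "x = Tick i" "y = Tick j" using T by auto
    then show False using ind[of x y] xy T by (auto simp: burling.indep_def)
  qed
  have lifts: "finite (A \<inter> Lift ` burling_vertices) \<and> card (A \<inter> Lift ` burling_vertices) \<le> 2"
  proof (rule finite_card_leI)
    fix T assume T: "T \<subseteq> A \<inter> Lift ` burling_vertices" "card T = Suc 2"
    then have "card T = 3" by simp
    then obtain x y z where xyz: "T = {x, y, z}" "x \<noteq> y" "y \<noteq> z" "x \<noteq> z"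
      unfolding card_3_iff by blast
    then obtain u v w where L: "x = Lift u" "y = Lift v" "z = Lift w"
      and F: "u \<in> burling_vertices" "v \<in> burling_vertices" "w \<in> burling_vertices" using T by auto
    have adj: "adjacent u v" "adjacent v w" "adjacent u w"
      using xyz T(1) L F ind[of x y] ind[of y z] ind[of x z] indep_imp_adjacent[of u v]
        indep_imp_adjacent[of v w] indep_imp_adjacent[of u w] by simp_all
    obtain i j l where "u \<in> stage i" "v \<in> stage j" "w \<in> stage l"
      using F by (auto simp: burling_vertices_def)
    then have "u \<in> stage (i + j + l)" "v \<in> stage (i + j + l)" "w \<in> stage (i + j + l)"
      using stage_mono[of i "i + j + l"] stage_mono[of j "i + j + l"] stage_mono[of l "i + j + l"] by auto
    then show False using stage_triangle_free adj by blast
  qed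
  have split: "A = (A \<inter> range Node) \<union> (A \<inter> range Tick) \<union> (A \<inter> Lift ` burling_vertices)"
    using A(1) unfolding events_def by blast
  have "card A \<le> card (A \<inter> range Node) + card (A \<inter> range Tick) + card (A \<inter> Lift ` burling_vertices)"
    by (subst split) (meson add_le_mono1 card_Un_le order.trans)
  moreover have "finite A"
    by (subst split) (use nodes ticks lifts in blast)
  ultimately show ?thesis using nodes ticks lifts by linarith
qed

text \<open>The empty word with one tick. The products of \<open>Copy [] Base\<close> and
  \<open>Apex [] []\<close> both contain this point, so two nodes, one tick and two lifts are
  enabled here.\<close>

definition corner :: "event set" where
  "corner = {Node [], Tick 0}"

lemma config_corner: "burling.config corner"
proof (rule burling.configI)
  show "f \<in> corner" if "e \<in> corner" "below f e" for e f
    using that by (cases f) (auto simp: corner_def)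
qed (auto simp: corner_def)

lemma enabled_corner: "5 \<le> card {e. burling.enabled corner e}"
proof -
  let ?T = "{Node [False], Node [True], Tick 1, Lift (Copy [] Base), Lift (Apex [] [])}"
  have "Copy [] Base \<in> stage 1" "Apex [] [] \<in> stage 1" by auto
  then have F: "Copy [] Base \<in> burling_vertices" "Apex [] [] \<in> burling_vertices"
    unfolding burling_vertices_def by blast+
  have down: "e = Node [] \<or> e = Tick 0 \<or> e = f" if "below e f" "f \<in> ?T" for e f
    using that by (cases e) (auto simp: prefix_Cons)
  have down0: "e = f" if "below e f" "f = Node [] \<or> f = Tick 0" for e f
    using that by (cases e) auto
  have "burling.enabled corner f" if f: "f \<in> ?T" for f
    unfolding burling.enabled_def
  proof
    show "f \<notin> corner" using f by (auto simp: corner_def)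
    show "burling.config (insert f corner)"
    proof (rule burling.configI)
      show "insert f corner \<subseteq> events" using f F by (auto simp: corner_def events_def)
      show "y \<in> insert f corner" if "x \<in> insert f corner" "y \<in> events" "below y x" for x y
        using down[of y f] down0[of y x] that f unfolding corner_def by blast
      show "\<not> clash x y" if "x \<in> insert f corner" "y \<in> insert f corner" for x y
        using that f by (auto simp: corner_def)
    qed (simp add: corner_def)
  qed
  then have "?T \<subseteq> {e. burling.enabled corner e}" by blast
  moreover have "finite {e. burling.enabled corner e}"
    using clique_bound[OF burling.enabled_subset burling.enabled_pairwise_indep[OF config_corner]] by blast
  moreover have "card ?T = 5" by simp
  ultimately show ?thesis by (metis card_mono)
qed

theorem theorem5:
  shows "\<exists>(V :: nat set) Adj \<alpha>. median_graph V Adj \<and> infinite V \<and> \<alpha> \<in> V \<and>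
     max_outdeg_eq V Adj \<alpha> 5 \<and>
     infinite_chromatic_contact V Adj \<alpha> \<and>
     ev_degree_eq V Adj \<alpha> 5 \<and>
     (\<forall>lab :: (nat \<times> nat) set \<Rightarrow> 'l. nice_labeling V Adj \<alpha> lab \<longrightarrow>
        infinite (lab ` theta_classes V Adj))"
proof -
  let ?K = "{C. burling.config C}"
  \<comment> \<open>There are only countably many finite configurations, and they are numbered by
    natural numbers.\<close>
  define V :: "nat set" where "V = to_nat_on ?K ` ?K"
  define S where "S = inv_into ?K (to_nat_on ?K)"
  have "countable ?K"
    by (rule countable_subset[OF _ countable_Collect_finite]) (auto simp: burling.config_def)
  then have "bij_betw S V ?K"
    unfolding S_def V_def by (intro bij_betw_inv_into inj_on_imp_bij_betw) auto
  then interpret config_graph events below clash V S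
    by unfold_locales
  have lift: "Lift v \<in> events" if "v \<in> burling_vertices" for v
    using that by (simp add: events_def)
  have infinite_colors: "infinite (lab ` theta_classes V Adj)"
    if "\<And>v w. \<lbrakk>v \<in> burling_vertices; w \<in> burling_vertices; adjacent v w\<rbrakk> \<Longrightarrow> lab (cls (Lift v)) \<noteq> lab (cls (Lift w))"
    for lab :: "(nat \<times> nat) set \<Rightarrow> 'c"
  proof
    assume fin: "finite (lab ` theta_classes V Adj)"
    \<comment> \<open>The supposed number of labels itself selects the stage, at one leaf of which
      more than \<open>n\<close> labels occur.\<close>
    define n where "n = card (lab ` theta_classes V Adj)"
    define col where "col v = lab (cls (Lift v))" for v
    have sub: "col ` stage n \<subseteq> lab ` theta_classes V Adj"
      using lift unfolding col_def theta_classes_eq burling_vertices_def by blast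
    have "col v \<noteq> col w" if "v \<in> stage n" "w \<in> stage n" "adjacent v w" for v w
      using that \<open>\<And>v w. \<lbrakk>v \<in> burling_vertices; w \<in> burling_vertices; adjacent v w\<rbrakk> \<Longrightarrow> lab (cls (Lift v)) \<noteq> lab (cls (Lift w))\<close>
      unfolding col_def burling_vertices_def by blast
    then obtain x where "n < card (col ` {v \<in> stage n. x \<in> subtree v})"
      using stage_many_colors[OF finite_subset[OF sub fin]] by blast
    moreover have "col ` {v \<in> stage n. x \<in> subtree v} \<subseteq> lab ` theta_classes V Adj"
      using sub by blast
    then have "card (col ` {v \<in> stage n. x \<in> subtree v}) \<le> n"
      unfolding n_def by (rule card_mono[OF fin])
    ultimately show False by simp
  qed
  have "infinite_chromatic_contact V Adj origin"
    unfolding infinite_chromatic_contact_def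
  proof (intro notI, elim exE conjE)
    fix col :: "(nat \<times> nat) set \<Rightarrow> nat"
    assume fin: "finite (col ` theta_classes V Adj)"
      and col: "\<forall>c\<in>theta_classes V Adj. \<forall>d\<in>theta_classes V Adj.
        contact_adj V Adj origin c d \<longrightarrow> col c \<noteq> col d"
    have "infinite (col ` theta_classes V Adj)"
    proof (rule infinite_colors)
      fix v w assume "v \<in> burling_vertices" "w \<in> burling_vertices" "adjacent v w"
      then have "contact_adj V Adj origin (cls (Lift v)) (cls (Lift w))"
        and "cls (Lift v) \<in> theta_classes V Adj" "cls (Lift w) \<in> theta_classes V Adj"
        using indep_contact_adj lift adjacent_imp_indep by (simp_all add: theta_classes_eq)
      then show "col (cls (Lift v)) \<noteq> col (cls (Lift w))" using col by blast
    qed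
    then show False using fin by simp
  qed
  moreover have "infinite (lab ` theta_classes V Adj)" if nice: "nice_labeling V Adj origin lab"
    for lab :: "(nat \<times> nat) set \<Rightarrow> 'l"
  proof (rule infinite_colors)
    fix v w assume "v \<in> burling_vertices" "w \<in> burling_vertices" "adjacent v w"
    then have "ev_independent V Adj origin (cls (Lift v)) (cls (Lift w))"
      and "cls (Lift v) \<in> theta_classes V Adj" "cls (Lift w) \<in> theta_classes V Adj"
      using ev_independent_iff lift adjacent_imp_indep by (simp_all add: theta_classes_eq)
    then show "lab (cls (Lift v)) \<noteq> lab (cls (Lift w))"
      using nice unfolding nice_labeling_def by blast
  qed
  moreover have "infinite events"
    using finite_subset[of "range Tick" events] range_inj_infinite[of Tick]
    by (auto simp: events_def inj_def)
  ultimately show ?thesis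
    using median_graph infinite_V code_in[OF burling.config_empty]
      max_outdeg_eqI[OF clique_bound config_corner enabled_corner]
      ev_degree_eqI[OF clique_bound config_corner enabled_corner] by blast
qed

end
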